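(* Let $G$ be a group. Every bounded quasi-positive definite function $\phi:G\to\mathbb{C}$ can be written in the form $$\phi(g)=\phi_1(g)-\phi_2(g)\quad (g\in G),$$ where $\phi_1$ is a positive definite function on $G$ and $\phi_2$ is a positive definite function of finite type on $G$.
   Context: A function $\phi:G\to\mathbb{C}$ is positive definite (PD) if $\phi(g^{-1})=\overline{\phi(g)}$ for all $g\in G$ and, for all $n\in\mathbb{N}$ and all $g_1,\dots,g_n\in G$, the matrix $(\phi(g_i^{-1}g_j))_{i,j=1}^n$ has no negative eigenvalues. Every PD function has the form $\phi(g)=(\pi(g)x,x)$ with $\pi$ a unitary representation of $G$ on a Hilbert space $H$ and $x\in H$; $\phi$ is PD of finite type if the corresponding representation is finite-dimensional, i.e. $\phi(g)=(\pi(g)x,x)$ for some unitary representation $\pi$ of $G$ on a finite-dimensional Hilbert space $H$ and some $x\in H$. A function $\phi:G\to\mathbb{C}$ is quasi-positive definite (QPD) if $\phi(g^{-1})=\overline{\phi(g)}$ for all $g\in G$ and there is $k\in\mathbb{N}$ such that, for any $n\in\mathbb{N}$ and any $g_1,\dots,g_n\in G$, the matrix $(\phi(g_i^{-1}g_j))_{i,j=1}^n$ has at most $k$ negative eigenvalues (counted with multiplicity). The group $G$ carries no topology. *)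

theory Defs
  imports "HOL-Algebra.Group" "Jordan_Normal_Form.Schur_Decomposition"
begin

definition hermitian_fun :: "('a, 'b) monoid_scheme \<Rightarrow> ('a \<Rightarrow> complex) \<Rightarrow> bool" where
  "hermitian_fun G \<phi> \<longleftrightarrow> (\<forall>g \<in> carrier G. \<phi> (inv\<^bsub>G\<^esub> g) = cnj (\<phi> g))"

text \<open>Points are families indexed by \<open>{..<n}\<close>, not necessarily distinct.\<close>

definition kernel_mat ::
  "('a, 'b) monoid_scheme \<Rightarrow> ('a \<Rightarrow> complex) \<Rightarrow> nat \<Rightarrow> (nat \<Rightarrow> 'a) \<Rightarrow> complex mat" where
  "kernel_mat G \<phi> n g = mat n n (\<lambda>(i, j). \<phi> (inv\<^bsub>G\<^esub> (g i) \<otimes>\<^bsub>G\<^esub> g j))"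

definition neg_eigenvalues :: "complex mat \<Rightarrow> complex set" where
  "neg_eigenvalues A = {e. eigenvalue A e \<and> e \<in> \<real> \<and> Re e < 0}"

text \<open>Multiplicities are algebraic; for the Hermitian matrices to which this is applied they
  agree with the geometric ones.\<close>

definition num_neg_eigenvalues :: "complex mat \<Rightarrow> nat" where
  "num_neg_eigenvalues A = (\<Sum>e \<in> neg_eigenvalues A. Polynomial.order e (char_poly A))"

definition positive_definite :: "('a, 'b) monoid_scheme \<Rightarrow> ('a \<Rightarrow> complex) \<Rightarrow> bool" where
  "positive_definite G \<phi> \<longleftrightarrow> hermitian_fun G \<phi> \<and>
     (\<forall>n g. (\<forall>i<n. g i \<in> carrier G) \<longrightarrow> neg_eigenvalues (kernel_mat G \<phi> n g) = {})"

definition quasi_positive_definite :: "('a, 'b) monoid_scheme \<Rightarrow> ('a \<Rightarrow> complex) \<Rightarrow> bool" where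
  "quasi_positive_definite G \<phi> \<longleftrightarrow> hermitian_fun G \<phi> \<and>
     (\<exists>k. \<forall>n g. (\<forall>i<n. g i \<in> carrier G) \<longrightarrow> num_neg_eigenvalues (kernel_mat G \<phi> n g) \<le> k)"

text \<open>The unitary group of the Hilbert space \<open>\<complex>\<^sup>d\<close>.\<close>

definition unitary_group :: "nat \<Rightarrow> complex mat monoid" where
  "unitary_group d =
     \<lparr>carrier = {U \<in> carrier_mat d d. mat_adjoint U * U = 1\<^sub>m d \<and> U * mat_adjoint U = 1\<^sub>m d},
      monoid.mult = (*), one = 1\<^sub>m d\<rparr>"

text \<open>Every finite-dimensional complex Hilbert space is isometrically isomorphic to some \<open>\<complex>\<^sup>d\<close>
  with its standard inner product \<open>\<bullet>c\<close> (linear in the first argument), so unitary representations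
  on finite-dimensional Hilbert spaces are modelled as homomorphisms into \<open>unitary_group d\<close>.
  The zero space \<open>d = 0\<close> is allowed.\<close>

definition positive_definite_finite_type ::
  "('a, 'b) monoid_scheme \<Rightarrow> ('a \<Rightarrow> complex) \<Rightarrow> bool" where
  "positive_definite_finite_type G \<phi> \<longleftrightarrow>
     (\<exists>d. \<exists>\<pi> \<in> hom G (unitary_group d). \<exists>x \<in> carrier_vec d.
        \<forall>g \<in> carrier G. \<phi> g = (\<pi> g *\<^sub>v x) \<bullet>c x)"

lemma mat_adjoint_carrier:
  assumes "A \<in> carrier_mat n m"
  shows "mat_adjoint A \<in> carrier_mat m n"
  using assms unfolding mat_adjoint_def by (auto simp: mat_of_rows_def)

lemma mat_adjoint_index:
  assumes "A \<in> carrier_mat n m" "i < m" "j < n"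
  shows "mat_adjoint A $$ (i, j) = conjugate (A $$ (j, i))"
  using assms unfolding mat_adjoint_def by (auto simp: mat_of_rows_def)

lemma mat_adjoint_mult:
  fixes A B :: "complex mat"
  assumes A: "A \<in> carrier_mat n n" and B: "B \<in> carrier_mat n n"
  shows "mat_adjoint (A * B) = mat_adjoint B * mat_adjoint A"
proof (rule eq_matI)
  note c = mat_adjoint_carrier[OF A] mat_adjoint_carrier[OF B]
  fix i j
  assume "i < dim_row (mat_adjoint B * mat_adjoint A)" "j < dim_col (mat_adjoint B * mat_adjoint A)"
  then have ij: "i < n" "j < n" using c by auto
  have "mat_adjoint (A * B) $$ (i, j) = cnj (\<Sum>k<n. A $$ (j, k) * B $$ (k, i))"
    using mat_adjoint_index[OF mult_carrier_mat[OF A B] ij] A B ij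
    by (simp add: scalar_prod_def atLeast0LessThan)
  also have "\<dots> = (\<Sum>k<n. mat_adjoint B $$ (i, k) * mat_adjoint A $$ (k, j))"
    using mat_adjoint_index[OF A] mat_adjoint_index[OF B] ij by (simp add: mult.commute)
  also have "\<dots> = (mat_adjoint B * mat_adjoint A) $$ (i, j)"
    using c ij by (simp add: scalar_prod_def atLeast0LessThan)
  finally show "mat_adjoint (A * B) $$ (i, j) = (mat_adjoint B * mat_adjoint A) $$ (i, j)" .
qed (use mat_adjoint_carrier[OF A] mat_adjoint_carrier[OF B]
      mat_adjoint_carrier[OF mult_carrier_mat[OF A B]] in auto)

lemma mat_adjoint_adjoint:
  fixes A :: "complex mat"
  assumes A: "A \<in> carrier_mat n n"
  shows "mat_adjoint (mat_adjoint A) = A"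
  by (rule eq_matI) (use A mat_adjoint_carrier[OF A] mat_adjoint_carrier[OF mat_adjoint_carrier[OF A]]
      mat_adjoint_index[OF A] mat_adjoint_index[OF mat_adjoint_carrier[OF A]] in auto)

lemma mat_adjoint_one: "mat_adjoint (1\<^sub>m n) = (1\<^sub>m n :: complex mat)"
  by (rule eq_matI) (use mat_adjoint_carrier[of "1\<^sub>m n :: complex mat" n n]
      mat_adjoint_index[of "1\<^sub>m n :: complex mat" n n] in auto)

lemma group_unitary_group: "group (unitary_group d)"
proof (rule groupI)
  fix U V assume "U \<in> carrier (unitary_group d)" "V \<in> carrier (unitary_group d)"
  then have U: "U \<in> carrier_mat d d" "mat_adjoint U * U = 1\<^sub>m d" "U * mat_adjoint U = 1\<^sub>m d"
    and V: "V \<in> carrier_mat d d" "mat_adjoint V * V = 1\<^sub>m d" "V * mat_adjoint V = 1\<^sub>m d"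
    by (auto simp: unitary_group_def)
  note U' = mat_adjoint_carrier[OF U(1)] and V' = mat_adjoint_carrier[OF V(1)]
  have "mat_adjoint V * mat_adjoint U * (U * V) = mat_adjoint V * (mat_adjoint U * U * V)"
    using U(1) V(1) U' V' by (simp add: assoc_mult_mat[of _ d d _ d _ d])
  moreover have "U * V * (mat_adjoint V * mat_adjoint U) = U * (V * mat_adjoint V * mat_adjoint U)"
    using U(1) V(1) U' V' by (simp add: assoc_mult_mat[of _ d d _ d _ d])
  ultimately show "U \<otimes>\<^bsub>unitary_group d\<^esub> V \<in> carrier (unitary_group d)"
    using U V U' V' by (simp add: unitary_group_def mat_adjoint_mult[OF U(1) V(1)])
next
  fix U assume "U \<in> carrier (unitary_group d)"
  then show "\<exists>V\<in>carrier (unitary_group d). V \<otimes>\<^bsub>unitary_group d\<^esub> U = \<one>\<^bsub>unitary_group d\<^esub>"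
    by (intro bexI[of _ "mat_adjoint U"])
      (auto simp: unitary_group_def mat_adjoint_adjoint intro: mat_adjoint_carrier)
qed (auto simp: unitary_group_def mat_adjoint_one assoc_mult_mat[of _ d d _ d _ d])

end

(* The kernel phi (t^-1 s) defines an invariant Hermitian form B on the free space over G, with
   finitely many negative squares. A maximal negative orthonormal system e gives a form N of finite
   rank with N >= 0 and N + B >= 0, and boundedness of phi makes G act by uniformly bounded operators
   for the norm B + 2N. The translates of N lie in the Hilbert space of Hilbert-Schmidt operators,
   where G acts by uniformly bounded maps; after renorming by orbit suprema the convex hull of the
   translates has an (asymptotic) center, so that N may be chosen invariant. Subtracting parallel
   sums of N and N + B repeatedly makes these two forms mutually singular. Then any N-orthonormal
   system can be perturbed into a negative family for B, so N has finite rank: it is a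
   finite-dimensional unitary representation, and evaluating N and N + B on the orbit of the unit
   point mass gives phi_2 and phi_1. *)
theory Submission
  imports Defs "HOL-Library.Poly_Mapping" "Jordan_Normal_Form.Jordan_Normal_Form_Existence"
begin

section \<open>Quadratic forms and parallel sums\<close>

text \<open>The obstacle is that \<open>G\<close> is an arbitrary group: no invariant mean need
  exist with which to average the translates of N. Uniform convexity takes its place, and this is
  why the forms are measured in a Hilbert-Schmidt norm, which obeys the parallelogram law. The
  weight 2 in B + 2N makes it the sum of the two positive forms N + B and N, so that it dominates
  both and controls B. The price of the limit is that the finite rank of N may be lost. Singularity
  restores it: when N and N + B are mutually singular, each vector has a substitute on which N is
  almost unchanged and N + B almost zero, so that B is close to -N there. The rank of the final N is
  therefore at most the bound on the number of negative eigenvalues. No Hilbert space is completed: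
  all norms are seminorms on finitely supported functions, and only limits of real numbers are
  taken.\<close>

locale complex_vector_space = vector_space scale
  for scale :: "complex \<Rightarrow> 'v::ab_group_add \<Rightarrow> 'v" (infixr \<open>*s\<close> 75)
begin

text \<open>Forms are recorded by their diagonal values, on which infima and limits are pointwise.
  Homogeneity for complex scalars, and not just for real ones, is what lets
  \<open>Jordan_von_Neumann\<close> return a sesquilinear form.\<close>

definition quad_form :: "('v \<Rightarrow> real) \<Rightarrow> bool" where
  "quad_form Q \<longleftrightarrow> (\<forall>c x. Q (c *s x) = (cmod c)\<^sup>2 * Q x) \<and>
     (\<forall>x y. Q (x + y) + Q (x - y) = 2 * Q x + 2 * Q y)"

definition pos_form :: "('v \<Rightarrow> real) \<Rightarrow> bool" where
  "pos_form Q \<longleftrightarrow> quad_form Q \<and> (\<forall>x. 0 \<le> Q x)"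

lemma quad_formI:
  assumes "\<And>c x. Q (c *s x) = (cmod c)\<^sup>2 * Q x"
    and "\<And>x y. Q (x + y) + Q (x - y) = 2 * Q x + 2 * Q y"
  shows "quad_form Q"
  using assms by (simp add: quad_form_def)

lemma quad_form_scale: "quad_form Q \<Longrightarrow> Q (c *s x) = (cmod c)\<^sup>2 * Q x"
  by (simp add: quad_form_def)

lemma quad_form_parallelogram: "quad_form Q \<Longrightarrow> Q (x + y) + Q (x - y) = 2 * Q x + 2 * Q y"
  by (simp add: quad_form_def)

lemma quad_form_zero: "quad_form Q \<Longrightarrow> Q 0 = 0"
  using quad_form_scale[of Q 0 0] by simp

lemma quad_form_minus: "quad_form Q \<Longrightarrow> Q (- x) = Q x"
  using quad_form_scale[of Q "-1" x] by simp

lemma quad_form_double: "quad_form Q \<Longrightarrow> Q (x + x) = 4 * Q x"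
  using quad_form_parallelogram[of Q x x] by (simp add: quad_form_zero)

lemma quad_form_add: "quad_form Q \<Longrightarrow> quad_form R \<Longrightarrow> quad_form (\<lambda>x. Q x + R x)"
  by (rule quad_formI) (simp_all add: quad_form_scale algebra_simps quad_form_def)

lemma quad_form_diff:
  assumes Q: "quad_form Q" and R: "quad_form R"
  shows "quad_form (\<lambda>x. Q x - R x)"
proof (rule quad_formI)
  show "Q (x + y) - R (x + y) + (Q (x - y) - R (x - y)) = 2 * (Q x - R x) + 2 * (Q y - R y)" for x y
    using quad_form_parallelogram[OF Q, of x y] quad_form_parallelogram[OF R, of x y] by simp
qed (simp add: quad_form_scale[OF Q] quad_form_scale[OF R] algebra_simps)

lemma quad_form_tendsto:
  assumes Q: "\<And>n. quad_form (Q n)" and lim: "\<And>x. (\<lambda>n. Q n x) \<longlonglongrightarrow> R x"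
  shows "quad_form R"
proof (rule quad_formI)
  show "R (c *s x) = (cmod c)\<^sup>2 * R x" for c x
    using LIMSEQ_unique[OF lim[of "c *s x"]] tendsto_mult_left[OF lim[of x], of "(cmod c)\<^sup>2"]
    by (simp add: quad_form_scale[OF Q])
  show "R (x + y) + R (x - y) = 2 * R x + 2 * R y" for x y
  proof (rule LIMSEQ_unique[OF tendsto_add[OF lim lim]])
    show "(\<lambda>n. Q n (x + y) + Q n (x - y)) \<longlonglongrightarrow> 2 * R x + 2 * R y"
      unfolding quad_form_parallelogram[OF Q] by (intro tendsto_intros lim)
  qed
qed

lemma pos_form_le:
  assumes "pos_form Q"
  shows "Q (x + y) \<le> 2 * Q x + 2 * Q y"
proof -
  have "Q (x + y) + Q (x - y) = 2 * Q x + 2 * Q y" "0 \<le> Q (x - y)"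
    using assms by (auto simp: pos_form_def quad_form_parallelogram)
  then show ?thesis by simp
qed

text \<open>Iterates \<open>pos_form_le\<close>. The crude factor is harmless because the errors in
  \<open>singular_negative_family\<close> are chosen after m.\<close>

lemma pos_form_sum_le:
  assumes Q: "pos_form Q"
  shows "Q (\<Sum>i<m. z i) \<le> 2 ^ m * (\<Sum>i<m. Q (z i))"
proof (induction m)
  case 0
  then show ?case using Q by (simp add: pos_form_def quad_form_zero)
next
  case (Suc m)
  have nn: "0 \<le> Q (z m)" "0 \<le> (\<Sum>i<m. Q (z i))"
    using Q by (auto simp: pos_form_def intro: sum_nonneg)
  have "Q (\<Sum>i<Suc m. z i) \<le> 2 * Q (\<Sum>i<m. z i) + 2 * Q (z m)"
    using pos_form_le[OF Q] by simp
  also have "\<dots> \<le> 2 * (2 ^ m * (\<Sum>i<m. Q (z i))) + 2 * 2 ^ m * Q (z m)"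
    using Suc mult_right_mono[of 1 "2 ^ m" "Q (z m)"] nn by simp
  finally show ?case by (simp add: algebra_simps)
qed

text \<open>For positive numbers p, q this is pq/(p+q), and for invertible positive operators the
  inverse of the sum of the inverses. Its vanishing expresses mutual singularity.\<close>

definition parallel_sum :: "('v \<Rightarrow> real) \<Rightarrow> ('v \<Rightarrow> real) \<Rightarrow> 'v \<Rightarrow> real" where
  "parallel_sum P Q x = (INF y. P (x - y) + Q y)"

lemma bdd_below_parallel_sum:
  "pos_form P \<Longrightarrow> pos_form Q \<Longrightarrow> bdd_below (range (\<lambda>y. P (x - y) + Q y))"
  by (rule bdd_belowI2[of _ 0]) (simp add: pos_form_def)

lemma parallel_sum_le:
  assumes "pos_form P" "pos_form Q"
  shows "parallel_sum P Q x \<le> P (x - y) + Q y"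
  unfolding parallel_sum_def by (rule cINF_lower[OF bdd_below_parallel_sum[OF assms]]) simp

lemma parallel_sum_nonneg:
  "pos_form P \<Longrightarrow> pos_form Q \<Longrightarrow> 0 \<le> parallel_sum P Q x"
  unfolding parallel_sum_def by (rule cINF_greatest) (auto simp: pos_form_def)

lemma parallel_sum_less:
  assumes "pos_form P" "pos_form Q" "parallel_sum P Q x < e"
  shows "\<exists>y. P (x - y) + Q y < e"
  using assms(3) unfolding parallel_sum_def
  by (simp add: cINF_less_iff bdd_below_parallel_sum[OF assms(1,2)])

lemma parallel_sum_mono:
  assumes "pos_form P" "pos_form Q" "pos_form P'" "pos_form Q'"
    and "\<And>x. P x \<le> P' x" "\<And>x. Q x \<le> Q' x"
  shows "parallel_sum P Q x \<le> parallel_sum P' Q' x"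
  unfolding parallel_sum_def[of P']
proof (rule cINF_greatest)
  fix y
  have "parallel_sum P Q x \<le> P (x - y) + Q y" using parallel_sum_le assms by blast
  also have "\<dots> \<le> P' (x - y) + Q' y" using assms by (intro add_mono) auto
  finally show "parallel_sum P Q x \<le> P' (x - y) + Q' y" .
qed simp

lemma parallel_sum_invariant:
  assumes add: "\<And>x y. T (x - y) = T x - T y" and "surj T"
    and "\<And>x. P (T x) = P x" "\<And>x. Q (T x) = Q x"
  shows "parallel_sum P Q (T x) = parallel_sum P Q x"
proof -
  have "range (\<lambda>y. P (T x - y) + Q y) = range (\<lambda>y. P (T x - T y) + Q (T y))"
    using \<open>surj T\<close> image_comp[of "\<lambda>y. P (T x - y) + Q y" T UNIV] by (simp add: comp_def)
  then show ?thesis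
    unfolding parallel_sum_def by (simp add: add[symmetric] assms(3,4))
qed

text \<open>Near-minimizers u and v for x and y yield the competitors u + v and u - v for x + y and
  x - y.\<close>

lemma parallel_sum_parallelogram_le:
  assumes P: "pos_form P" and Q: "pos_form Q"
  shows "parallel_sum P Q (x + y) + parallel_sum P Q (x - y)
    \<le> 2 * parallel_sum P Q x + 2 * parallel_sum P Q y"
proof (rule field_le_epsilon)
  fix e :: real assume "0 < e"
  obtain u v where u: "P (x - u) + Q u < parallel_sum P Q x + e / 4"
    and v: "P (y - v) + Q v < parallel_sum P Q y + e / 4"
    using parallel_sum_less[OF P Q, of x "parallel_sum P Q x + e / 4"]
      parallel_sum_less[OF P Q, of y "parallel_sum P Q y + e / 4"] \<open>0 < e\<close> by auto
  have "parallel_sum P Q (x + y) + parallel_sum P Q (x - y)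
      \<le> (P ((x - u) + (y - v)) + Q (u + v)) + (P ((x - u) - (y - v)) + Q (u - v))"
    using parallel_sum_le[OF P Q, of "x + y" "u + v"] parallel_sum_le[OF P Q, of "x - y" "u - v"]
    by (simp add: algebra_simps)
  also have "\<dots> = 2 * (P (x - u) + Q u) + 2 * (P (y - v) + Q v)"
    using quad_form_parallelogram[of P "x - u" "y - v"] quad_form_parallelogram[of Q u v] P Q
    by (simp add: pos_form_def)
  also have "\<dots> \<le> 2 * parallel_sum P Q x + 2 * parallel_sum P Q y + e"
    using u v by simp
  finally show "parallel_sum P Q (x + y) + parallel_sum P Q (x - y)
    \<le> 2 * parallel_sum P Q x + 2 * parallel_sum P Q y + e" .
qed

text \<open>Each law follows from an inequality that reverses under a substitution:
  \<open>inverse c\<close> undoes c, and passing from x, y to x + y, x - y doubles the arguments,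
  which homogeneity turns into a factor 4.\<close>

lemma pos_form_parallel_sum:
  assumes P: "pos_form P" and Q: "pos_form Q"
  shows "pos_form (parallel_sum P Q)"
proof -
  let ?M = "parallel_sum P Q"
  have le: "?M (c *s x) \<le> (cmod c)\<^sup>2 * ?M x" if "c \<noteq> 0" for c x
  proof -
    have "?M (c *s x) / (cmod c)\<^sup>2 \<le> ?M x"
      unfolding parallel_sum_def[of P Q x]
    proof (rule cINF_greatest)
      fix y
      have "?M (c *s x) \<le> P (c *s (x - y)) + Q (c *s y)"
        using parallel_sum_le[OF P Q, of "c *s x" "c *s y"] by (simp add: scale_right_diff_distrib)
      also have "\<dots> = (cmod c)\<^sup>2 * (P (x - y) + Q y)"
        using P Q by (simp add: pos_form_def quad_form_scale[of P c "x - y"] quad_form_scale[of Q c y] distrib_left)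
      finally show "?M (c *s x) / (cmod c)\<^sup>2 \<le> P (x - y) + Q y"
        using that by (simp add: divide_le_eq mult.commute)
    qed simp
    then show ?thesis using that by (simp add: field_simps)
  qed
  have zero: "?M 0 = 0"
    using parallel_sum_le[OF P Q, of 0 0] parallel_sum_nonneg[OF P Q, of 0] P Q
    by (simp add: pos_form_def quad_form_zero)
  have scale: "?M (c *s x) = (cmod c)\<^sup>2 * ?M x" for c x
  proof (cases "c = 0")
    case False
    then have "?M x \<le> (cmod (inverse c))\<^sup>2 * ?M (c *s x)"
      using le[of "inverse c" "c *s x"] by simp
    then have "(cmod c)\<^sup>2 * ?M x \<le> ?M (c *s x)"
      using False by (simp only: norm_inverse power_inverse) (simp add: divide_simps mult.commute)
    with le[OF False] show ?thesis by (simp add: antisym)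
  qed (simp add: zero)
  have "?M (x + y) + ?M (x - y) = 2 * ?M x + 2 * ?M y" for x y
  proof -
    have "?M (2 *s x) + ?M (2 *s y) \<le> 2 * ?M (x + y) + 2 * ?M (x - y)"
      using parallel_sum_parallelogram_le[OF P Q, of "x + y" "x - y"]
      by (simp add: scale_left_distrib[of 1 1, simplified])
    with parallel_sum_parallelogram_le[OF P Q, of x y] show ?thesis by (simp add: scale)
  qed
  then show ?thesis
    using scale parallel_sum_nonneg[OF P Q] by (simp add: pos_form_def quad_form_def)
qed

text \<open>Subtracting the parallel sum from both forms squares the relative spectrum, so iterating this
  converges to a pair of mutually singular forms with the same difference.\<close>

lemma singular_decomposition:
  assumes b: "quad_form b" and N: "pos_form N" and P: "pos_form (\<lambda>x. N x + b x)"
    and Tdiff: "\<And>T x y. T \<in> \<T> \<Longrightarrow> T (x - y) = T x - T y" and Tsurj: "\<And>T. T \<in> \<T> \<Longrightarrow> surj T"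
    and TN: "\<And>T x. T \<in> \<T> \<Longrightarrow> N (T x) = N x" and Tb: "\<And>T x. T \<in> \<T> \<Longrightarrow> b (T x) = b x"
  obtains M where "pos_form M" "pos_form (\<lambda>x. M x + b x)"
    "\<And>x. parallel_sum M (\<lambda>x. M x + b x) x = 0" "\<And>T x. T \<in> \<T> \<Longrightarrow> M (T x) = M x"
proof -
  \<comment> \<open>In a direction where both forms are diagonal with values n and p, this replaces
    n by n - np/(n+p) = n^2/(n+p) and likewise p by p^2/(n+p): the ratio is squared and p - n is
    unchanged.\<close>
  define step where "step N = (\<lambda>x. N x - parallel_sum N (\<lambda>x. N x + b x) x)" for N
  define A where "A n = (step ^^ n) N" for n
  define D where "D n = parallel_sum (A n) (\<lambda>x. A n x + b x)" for n
  have A_Suc: "A (Suc n) x = A n x - D n x" for n x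
    by (simp add: A_def D_def step_def)
  have inv: "pos_form (A n) \<and> pos_form (\<lambda>x. A n x + b x) \<and> (\<forall>T\<in>\<T>. \<forall>x. A n (T x) = A n x)" for n
  proof (induction n)
    case 0
    then show ?case using assms by (simp add: A_def)
  next
    case (Suc n)
    then have p: "pos_form (A n)" "pos_form (\<lambda>x. A n x + b x)" by auto
    have D: "pos_form (D n)" unfolding D_def by (rule pos_form_parallel_sum[OF p])
    \<comment> \<open>The competitors 0 and x in the infimum bound the parallel sum by either form,
      so both stay nonnegative after the subtraction.\<close>
    have "D n x \<le> A n x" for x
      using parallel_sum_le[OF p, of x 0] p b by (simp add: D_def pos_form_def quad_form_zero)
    moreover have "D n x \<le> A n x + b x" for x
      using parallel_sum_le[OF p, of x x] p b by (simp add: D_def pos_form_def quad_form_zero)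
    moreover have "quad_form (A (Suc n))"
      unfolding A_Suc using p D by (auto simp: pos_form_def intro: quad_form_diff)
    moreover from calculation have "0 \<le> A (Suc n) x" "0 \<le> A (Suc n) x + b x" for x
      by (simp_all add: A_Suc diff_add_eq)
    ultimately have "pos_form (A (Suc n)) \<and> pos_form (\<lambda>x. A (Suc n) x + b x)"
      using quad_form_add[of "A (Suc n)", OF _ b] by (auto simp: pos_form_def)
    moreover
    have "D n (T x) = D n x" if "T \<in> \<T>" for T x
      unfolding D_def by (rule parallel_sum_invariant) (use Suc that Tdiff Tsurj Tb in auto)
    then have "\<forall>T\<in>\<T>. \<forall>x. A (Suc n) (T x) = A (Suc n) x" using Suc by (simp add: A_Suc)
    ultimately show ?case by simp
  qed
  then have p: "pos_form (A n)" "pos_form (\<lambda>x. A n x + b x)" for n by auto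
  have D0: "0 \<le> D n x" for n x unfolding D_def by (rule parallel_sum_nonneg[OF p])
  have dec: "decseq (\<lambda>n. A n x)" for x using D0 by (auto simp: decseq_Suc_iff A_Suc)
  have "\<exists>l. (\<lambda>n. A n x) \<longlonglongrightarrow> l \<and> (\<forall>n. l \<le> A n x)" for x
    by (rule decseq_convergent[OF dec, of 0]) (use p in \<open>auto simp: pos_form_def\<close>)
  then obtain M where lim: "\<And>x. (\<lambda>n. A n x) \<longlonglongrightarrow> M x" and le: "\<And>n x. M x \<le> A n x"
    by metis
  have q: "quad_form M" by (rule quad_form_tendsto[OF _ lim]) (use p in \<open>auto simp: pos_form_def\<close>)
  have M: "pos_form M" unfolding pos_form_def
    using q LIMSEQ_le_const[OF lim] p by (auto simp: pos_form_def)
  have Mb: "pos_form (\<lambda>x. M x + b x)" unfolding pos_form_def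
    using quad_form_add[OF q b] LIMSEQ_le_const[OF tendsto_add[OF lim tendsto_const]] p
    by (auto simp: pos_form_def)
  \<comment> \<open>\<open>D n\<close> is the gap between consecutive terms of a convergent
    sequence, so it tends to 0; as \<open>M\<close> lies below every \<open>A n\<close>, its
    parallel sum lies below every \<open>D n\<close>.\<close>
  have "parallel_sum M (\<lambda>x. M x + b x) x = 0" for x
  proof (rule antisym)
    have "(\<lambda>n. A n x - A (Suc n) x) \<longlonglongrightarrow> M x - M x"
      by (intro tendsto_diff lim LIMSEQ_Suc)
    then have "(\<lambda>n. D n x) \<longlonglongrightarrow> 0" by (simp add: A_Suc)
    moreover have "parallel_sum M (\<lambda>x. M x + b x) x \<le> D n x" for n
      unfolding D_def using le by (intro parallel_sum_mono M Mb p) auto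
    ultimately show "parallel_sum M (\<lambda>x. M x + b x) x \<le> 0"
      using LIMSEQ_le_const by blast
  qed (rule parallel_sum_nonneg[OF M Mb])
  moreover have "M (T x) = M x" if "T \<in> \<T>" for T x
    using LIMSEQ_unique[OF lim[of "T x"]] lim[of x] inv that by simp
  ultimately show ?thesis using that M Mb by blast
qed

section \<open>Hermitian forms\<close>

definition hermitian_form :: "('v \<Rightarrow> 'v \<Rightarrow> complex) \<Rightarrow> bool" where
  "hermitian_form S \<longleftrightarrow> (\<forall>x y z. S (x + y) z = S x z + S y z) \<and>
     (\<forall>c x z. S (c *s x) z = c * S x z) \<and> (\<forall>x y. S y x = cnj (S x y))"

lemma hermitian_formI:
  assumes "\<And>x y z. S (x + y) z = S x z + S y z" "\<And>c x z. S (c *s x) z = c * S x z"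
    and "\<And>x y. S y x = cnj (S x y)"
  shows "hermitian_form S"
  unfolding hermitian_form_def using assms by blast

lemma hermitian_form_commute: "hermitian_form S \<Longrightarrow> S y x = cnj (S x y)"
  unfolding hermitian_form_def by blast

lemma hermitian_form_add_left: "hermitian_form S \<Longrightarrow> S (x + y) z = S x z + S y z"
  unfolding hermitian_form_def by blast

lemma hermitian_form_scale_left: "hermitian_form S \<Longrightarrow> S (c *s x) z = c * S x z"
  unfolding hermitian_form_def by blast

lemma hermitian_form_add_right:
  assumes "hermitian_form S" shows "S z (x + y) = S z x + S z y"
  by (subst (1 2 3) hermitian_form_commute[OF assms]) (simp add: hermitian_form_add_left[OF assms])

lemma hermitian_form_scale_right:
  assumes "hermitian_form S" shows "S z (c *s x) = cnj c * S z x"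
  by (subst (1 2) hermitian_form_commute[OF assms]) (simp add: hermitian_form_scale_left[OF assms])

lemma hermitian_form_minus_left: "hermitian_form S \<Longrightarrow> S (- x) z = - S x z"
  using hermitian_form_scale_left[of S "-1" x z] by simp

lemma hermitian_form_minus_right: "hermitian_form S \<Longrightarrow> S z (- x) = - S z x"
  using hermitian_form_scale_right[of S z "-1" x] by simp

lemma hermitian_form_diff_left: "hermitian_form S \<Longrightarrow> S (x - y) z = S x z - S y z"
  using hermitian_form_add_left[of S x "- y" z] by (simp add: hermitian_form_minus_left)

lemma hermitian_form_diff_right: "hermitian_form S \<Longrightarrow> S z (x - y) = S z x - S z y"
  using hermitian_form_add_right[of S z x "- y"] by (simp add: hermitian_form_minus_right)

lemma hermitian_form_zero_left: "hermitian_form S \<Longrightarrow> S 0 z = 0"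
  using hermitian_form_scale_left[of S 0 0 z] by simp

lemma hermitian_form_zero_right: "hermitian_form S \<Longrightarrow> S z 0 = 0"
  using hermitian_form_scale_right[of S z 0 0] by simp

lemma hermitian_form_sum_left: "hermitian_form S \<Longrightarrow> S (\<Sum>i\<in>I. f i) z = (\<Sum>i\<in>I. S (f i) z)"
  by (induction I rule: infinite_finite_induct)
    (simp_all add: hermitian_form_zero_left hermitian_form_add_left)

lemma hermitian_form_sum_right: "hermitian_form S \<Longrightarrow> S z (\<Sum>i\<in>I. f i) = (\<Sum>i\<in>I. S z (f i))"
  by (induction I rule: infinite_finite_induct)
    (simp_all add: hermitian_form_zero_right hermitian_form_add_right)

lemmas hermitian_form_simps =
  hermitian_form_add_left hermitian_form_add_right hermitian_form_diff_left hermitian_form_diff_right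
  hermitian_form_scale_left hermitian_form_scale_right hermitian_form_minus_left
  hermitian_form_minus_right hermitian_form_sum_left hermitian_form_sum_right
  hermitian_form_zero_left hermitian_form_zero_right

lemma hermitian_form_self: "hermitian_form S \<Longrightarrow> S x x = of_real (Re (S x x))"
  using arg_cong[OF hermitian_form_commute[of S x x], of Im] by (simp add: complex_eq_iff)

lemma hermitian_form_uminus: "hermitian_form S \<Longrightarrow> hermitian_form (\<lambda>x y. - S x y)"
  by (rule hermitian_formI) (simp_all add: hermitian_form_simps, metis hermitian_form_commute complex_cnj_minus)

lemma quad_form_Re_hermitian_form:
  assumes S: "hermitian_form S"
  shows "quad_form (\<lambda>x. Re (S x x))"
proof (rule quad_formI)
  show "Re (S (c *s x) (c *s x)) = (cmod c)\<^sup>2 * Re (S x x)" for c x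
    by (simp add: hermitian_form_simps[OF S] mult.assoc[symmetric] cmod_power2 flip: power2_eq_square)
qed (simp add: hermitian_form_simps[OF S])

lemma hermitian_form_Cauchy_Schwarz:
  assumes S: "hermitian_form S" and nn: "\<And>x. 0 \<le> Re (S x x)"
  shows "(cmod (S x y))\<^sup>2 \<le> Re (S x x) * Re (S y y)"
proof -
  \<comment> \<open>The factor S x y in the test vector makes the cross terms real.\<close>
  have ineq: "0 \<le> Re (S x x) - 2 * t * (cmod (S x y))\<^sup>2 + t\<^sup>2 * (cmod (S x y))\<^sup>2 * Re (S y y)" for t :: real
  proof -
    define s where "s = S x y"
    have yx: "S y x = cnj s" unfolding s_def by (rule hermitian_form_commute[OF S])
    have "S (x - (of_real t * s) *s y) (x - (of_real t * s) *s y)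
       = S x x - of_real (2 * t) * (s * cnj s) + of_real (t\<^sup>2) * (s * cnj s) * S y y"
      by (simp add: hermitian_form_simps[OF S] yx s_def[symmetric] algebra_simps power2_eq_square)
    then have "Re (S (x - (of_real t * s) *s y) (x - (of_real t * s) *s y))
       = Re (S x x) - 2 * t * (cmod s)\<^sup>2 + t\<^sup>2 * (cmod s)\<^sup>2 * Re (S y y)"
      unfolding complex_norm_square[symmetric] of_real_mult[symmetric] by simp
    then show ?thesis using nn[of "x - (of_real t * s) *s y"] by (simp add: s_def)
  qed
  show ?thesis
  proof (cases "Re (S y y) = 0")
    case True
    then have *: "0 \<le> Re (S x x) - 2 * t * (cmod (S x y))\<^sup>2" for t using ineq[of t] by simp
    have "cmod (S x y) = 0"
    proof (rule ccontr)
      assume "cmod (S x y) \<noteq> 0"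
      then show False
        \<comment> \<open>At this t the bound reads 0 \<le> - Re (S x x) - 2.\<close>
        using *[of "(Re (S x x) + 1) / (cmod (S x y))\<^sup>2"] nn[of x] by simp
    qed
    then show ?thesis using True by simp
  next
    case False
    then have pos: "0 < Re (S y y)" using nn[of y] by linarith
    have "0 \<le> Re (S x x) - (cmod (S x y))\<^sup>2 / Re (S y y)"
      using ineq[of "1 / Re (S y y)"] pos by (simp add: field_simps power2_eq_square)
    then show ?thesis using pos by (simp add: field_simps)
  qed
qed

text \<open>Subtracting the linear function leaves an additive h that vanishes at the integers. It
  is then periodic, hence bounded everywhere, and a bounded additive function is zero.\<close>

lemma additive_bounded_imp_homogeneous:
  fixes f :: "real \<Rightarrow> real"
  assumes add: "\<And>s t. f (s + t) = f s + f t" and bound: "\<And>t. 0 \<le> t \<Longrightarrow> t \<le> 1 \<Longrightarrow> \<bar>f t\<bar> \<le> K"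
  shows "f t = t * f 1"
proof -
  define h where "h t = f t - t * f 1" for t
  have h_add: "h (s + t) = h s + h t" for s t by (simp add: h_def add algebra_simps)
  have h1: "h 1 = 0" by (simp add: h_def)
  have h0: "h 0 = 0" using h_add[of 0 0] by simp
  have h_minus: "h (- t) = - h t" for t using h_add[of t "- t"] h0 by simp
  have h_nat: "h (real n * t) = real n * h t" for n t
    by (induction n) (simp_all add: h0 h_add distrib_right)
  have h_int: "h (real_of_int n) = 0" for n
    using h_nat[of "nat n" 1] h_nat[of "nat (- n)" 1] h_minus[of "real_of_int (- n)"] h1
    by (cases "n \<ge> 0") simp_all
  have bounded: "\<bar>h t\<bar> \<le> K + \<bar>f 1\<bar>" for t
  proof -
    have "h t = h (frac t)"
      using h_add[of "frac t" "of_int \<lfloor>t\<rfloor>"] h_int by (simp add: frac_def)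
    moreover have "frac t * \<bar>f 1\<bar> \<le> 1 * \<bar>f 1\<bar>"
      by (rule mult_right_mono) (use frac_lt_1[of t] in auto)
    then have "\<bar>frac t * f 1\<bar> \<le> \<bar>f 1\<bar>" by (simp add: abs_mult)
    ultimately show ?thesis
      using bound[of "frac t"] frac_lt_1[of t] frac_ge_0[of t] unfolding h_def by linarith
  qed
  have "h t = 0"
  proof (rule ccontr)
    assume "h t \<noteq> 0"
    then obtain n where "K + \<bar>f 1\<bar> < real n * \<bar>h t\<bar>"
      using reals_Archimedean3[of "\<bar>h t\<bar>"] by auto
    then show False using bounded[of "real n * t"] by (simp add: h_nat abs_mult)
  qed
  then show ?thesis by (simp add: h_def)
qed

theorem Jordan_von_Neumann:
  assumes N: "pos_form N"
  obtains S where "hermitian_form S" "\<And>x. Re (S x x) = N x"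
proof -
  note q = N[unfolded pos_form_def, THEN conjunct1]
  note par = quad_form_parallelogram[OF q]
  define R where "R x y = (N (x + y) - N (x - y)) / 4" for x y
  have R_sym: "R x y = R y x" for x y
    using quad_form_minus[OF q, of "x - y"] by (simp add: R_def add.commute)
  have R_par: "R (x + z) y + R (x - z) y = 2 * R x y" for x y z
  proof -
    have "x + z + y = (x + y) + z" "x - z + y = (x + y) - z" "x + z - y = (x - y) + z"
      "x - z - y = (x - y) - z"
      by (simp_all add: algebra_simps)
    with par[of "x + y" z] par[of "x - y" z] show ?thesis by (simp only: R_def) argo
  qed
  have R_double: "R (x + x) y = 2 * R x y" for x y
    using R_par[of x x y] quad_form_minus[OF q, of y] by (simp add: R_def)
  \<comment> \<open>Every pair u, v has the form x + z, x - z, so \<open>R_par\<close> together with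
    \<open>R_double\<close> is already additivity.\<close>
  have R_add: "R (u + v) y = R u y + R v y" for u v y
  proof -
    define x where "x = (1/2) *s (u + v)"
    define z where "z = (1/2) *s (u - v)"
    have half: "(1/2) *s w + (1/2) *s w = w" for w
      by (simp flip: scale_left_distrib)
    have "x + z = u" "x - z = v" "x + x = u + v"
      using half[of u] half[of v] half[of "u + v"]
      by (simp_all add: x_def z_def scale_right_distrib scale_right_diff_distrib)
    then show ?thesis using R_par[of x z y] R_double[of x y] by simp
  qed
  \<comment> \<open>The bound on the unit interval comes from nonnegativity and the parallelogram
    law; it takes the place of a continuity argument.\<close>
  have R_real: "R (of_real t *s x) y = t * R x y" for t x y
  proof -
    have "\<bar>R (of_real t *s x) y\<bar> \<le> (N x + N y) / 2" if "0 \<le> t" "t \<le> 1" for t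
    proof -
      have nn: "0 \<le> N (of_real t *s x + y)" "0 \<le> N (of_real t *s x - y)"
        using N by (auto simp: pos_form_def)
      have "t\<^sup>2 * N x \<le> N x"
        using that N by (simp add: pos_form_def mult_left_le_one_le power_le_one)
      then show ?thesis
        using par[of "of_real t *s x" y] nn by (simp add: R_def quad_form_scale[OF q])
    qed
    then have "R (of_real t *s x) y = t * R (of_real 1 *s x) y"
      by (intro additive_bounded_imp_homogeneous[where K = "(N x + N y) / 2"]) (auto simp: scale_left_distrib R_add)
    then show ?thesis by simp
  qed
  have R_i: "R (\<i> *s x) (\<i> *s y) = R x y" for x y
    using quad_form_scale[OF q, of \<i> "x + y"] quad_form_scale[OF q, of \<i> "x - y"]
    by (simp add: R_def scale_right_distrib scale_right_diff_distrib)
  have R_minus: "R (- x) y = - R x y" for x y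
    using R_real[of "-1" x y] by simp
  have R_i': "R x (\<i> *s y) = - R (\<i> *s x) y" for x y
    using R_i[of x "\<i> *s y"] R_minus[of y "\<i> *s x"] by (simp add: R_sym)
  \<comment> \<open>Conjugate linearity in the second argument dictates the imaginary part: Im (S x
    y) = Re (S x (i y)).\<close>
  define S where "S x y = Complex (R x y) (R x (\<i> *s y))" for x y
  have "hermitian_form S"
  proof (rule hermitian_formI)
    fix c x z
    have "c *s x = of_real (Re c) *s x + of_real (Im c) *s \<i> *s x"
      by (simp flip: scale_left_distrib) (simp add: complex_eq_iff)
    then have "R (c *s x) w = Re c * R x w + Im c * R (\<i> *s x) w" for w
      by (simp only: R_add R_real)
    then show "S (c *s x) z = c * S x z"
      by (simp add: S_def complex_eq_iff R_i R_i'[of x z])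
  next
    fix x y
    show "S y x = cnj (S x y)"
      using R_sym[of y x] R_sym[of y "\<i> *s x"] R_i'[of x y] by (simp add: S_def complex_eq_iff)
  qed (simp add: S_def complex_eq_iff R_add)
  moreover have "Re (S x x) = N x" for x
    using quad_form_double[OF q, of x] by (simp add: S_def R_def quad_form_zero[OF q])
  ultimately show ?thesis using that by blast
qed

section \<open>Orthonormal systems, negative definite subspaces and asymptotic centers\<close>

definition orthonormal :: "('v \<Rightarrow> 'v \<Rightarrow> complex) \<Rightarrow> nat \<Rightarrow> (nat \<Rightarrow> 'v) \<Rightarrow> bool" where
  "orthonormal S m u \<longleftrightarrow> (\<forall>i<m. \<forall>j<m. S (u i) (u j) = of_bool (i = j))"

lemma orthonormal_sum:
  assumes "orthonormal S m u" "j < m"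
  shows "(\<Sum>i<m. c i * S (u i) (u j)) = c j" "(\<Sum>i<m. c i * S (u j) (u i)) = c j"
proof -
  have "(\<Sum>i<m. c i * S (u i) (u j)) = (\<Sum>i<m. if i = j then c i else 0)"
    using assms by (intro sum.cong) (auto simp: orthonormal_def)
  then show "(\<Sum>i<m. c i * S (u i) (u j)) = c j" using assms by simp
  have "(\<Sum>i<m. c i * S (u j) (u i)) = (\<Sum>i<m. if i = j then c i else 0)"
    using assms by (intro sum.cong) (auto simp: orthonormal_def)
  then show "(\<Sum>i<m. c i * S (u j) (u i)) = c j" using assms by simp
qed

lemma orthonormal_norm:
  assumes S: "hermitian_form S" and u: "orthonormal S m u"
  shows "S (\<Sum>i<m. c i *s u i) (\<Sum>i<m. c i *s u i) = of_real (\<Sum>i<m. (cmod (c i))\<^sup>2)"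
proof -
  have "S (\<Sum>i<m. c i *s u i) (\<Sum>i<m. c i *s u i) = (\<Sum>j<m. cnj (c j) * (\<Sum>i<m. c i * S (u i) (u j)))"
    by (simp add: hermitian_form_simps[OF S])
  also have "\<dots> = (\<Sum>j<m. cnj (c j) * c j)"
    by (rule sum.cong) (simp_all add: orthonormal_sum[OF u])
  finally show ?thesis by (simp add: complex_norm_square mult.commute del: of_real_power)
qed

lemma maximal_orthonormal:
  assumes bound: "\<And>m u. orthonormal S m u \<Longrightarrow> m \<le> k"
  obtains m u where "orthonormal S m u" "\<And>u'. \<not> orthonormal S (Suc m) u'"
proof -
  let ?P = "\<lambda>m. \<exists>u. orthonormal S m u"
  have P0: "?P 0" by (simp add: orthonormal_def)
  have "?P (Greatest ?P)" by (rule GreatestI_nat[of ?P, OF P0, where b = k]) (use bound in blast)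
  moreover have "\<not> ?P (Suc (Greatest ?P))"
    using Greatest_le_nat[of ?P "Suc (Greatest ?P)" k] bound by fastforce
  ultimately show ?thesis using that by blast
qed

text \<open>Reverse Bessel inequality: the remainder after projection is orthogonal to
  \<open>u\<close>, so if its square were positive, normalizing it would give a longer system.
  \<open>S\<close> may be indefinite. For -B this yields b + N0 \<ge> 0; for a positive form it
  leads to Parseval's identity.\<close>

lemma maximal_orthonormal_norm_le:
  assumes S: "hermitian_form S" and u: "orthonormal S m u"
    and max: "\<And>u'. \<not> orthonormal S (Suc m) u'"
  shows "Re (S x x) \<le> (\<Sum>i<m. (cmod (S x (u i)))\<^sup>2)"
    and "S (x - (\<Sum>i<m. S x (u i) *s u i)) (x - (\<Sum>i<m. S x (u i) *s u i))
      = of_real (Re (S x x) - (\<Sum>i<m. (cmod (S x (u i)))\<^sup>2))"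
proof -
  define p where "p = (\<Sum>i<m. S x (u i) *s u i)"
  define z where "z = x - p"
  have zu: "S z (u j) = 0" if "j < m" for j
    using orthonormal_sum(1)[OF u that] by (simp add: z_def p_def hermitian_form_simps[OF S])
  then have uz: "S (u j) z = 0" if "j < m" for j
    using hermitian_form_commute[OF S, of "u j" z] that by simp
  have "S z p = 0" by (simp add: p_def hermitian_form_simps[OF S] zu)
  then have "S z z = S z x" unfolding z_def[of] by (simp add: hermitian_form_simps[OF S])
  also have "\<dots> = S x x - (\<Sum>i<m. S x (u i) * S (u i) x)"
    by (simp add: z_def p_def hermitian_form_simps[OF S])
  also have "(\<Sum>i<m. S x (u i) * S (u i) x) = (\<Sum>i<m. of_real ((cmod (S x (u i)))\<^sup>2))"
    by (rule sum.cong) (simp_all add: hermitian_form_commute[OF S, of _ x] complex_norm_square del: of_real_power)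
  finally have zz: "S z z = of_real (Re (S x x) - (\<Sum>i<m. (cmod (S x (u i)))\<^sup>2))"
    using hermitian_form_self[OF S, of x] by simp
  then show "S (x - (\<Sum>i<m. S x (u i) *s u i)) (x - (\<Sum>i<m. S x (u i) *s u i))
      = of_real (Re (S x x) - (\<Sum>i<m. (cmod (S x (u i)))\<^sup>2))"
    by (simp add: z_def p_def)
  show "Re (S x x) \<le> (\<Sum>i<m. (cmod (S x (u i)))\<^sup>2)"
  proof (rule ccontr)
    define r where "r = Re (S x x) - (\<Sum>i<m. (cmod (S x (u i)))\<^sup>2)"
    assume "\<not> ?thesis"
    then have r: "0 < r" by (simp add: r_def)
    define w where "w = of_real (1 / sqrt r) *s z"
    have "S w w = of_real (1 / sqrt r * (1 / sqrt r) * r)"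
      unfolding w_def hermitian_form_simps[OF S] zz r_def[symmetric]
      by (simp only: of_real_mult complex_cnj_complex_of_real mult.assoc)
    also have "1 / sqrt r * (1 / sqrt r) * r = 1"
      using r real_sqrt_mult_self[of r] by (simp del: real_sqrt_mult_self)
    finally have "S w w = 1" by simp
    moreover have "S w (u j) = 0" "S (u j) w = 0" if "j < m" for j
      using zu uz that by (simp_all add: w_def hermitian_form_simps[OF S])
    ultimately have "orthonormal S (Suc m) (u(m := w))"
      using u by (auto simp: orthonormal_def less_Suc_eq)
    with max show False by blast
  qed
qed

text \<open>A basis of an m-dimensional negative definite subspace in terms of coefficients. For a
  quadratic form b independence is automatic, since b 0 = 0.\<close>

definition negative_family :: "('v \<Rightarrow> real) \<Rightarrow> nat \<Rightarrow> (nat \<Rightarrow> 'v) \<Rightarrow> bool" where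
  "negative_family b m y \<longleftrightarrow> (\<forall>c. (\<exists>i<m. c i \<noteq> 0) \<longrightarrow> b (\<Sum>i<m. c i *s y i) < 0)"

lemma sum_cmod_square_pos: "\<exists>i<m. c i \<noteq> 0 \<Longrightarrow> 0 < (\<Sum>i<m. (cmod (c i))\<^sup>2)" for m :: nat
  by (auto intro: sum_pos2)

lemma negative_family_orthonormal:
  assumes B: "hermitian_form B" and u: "orthonormal (\<lambda>x y. - B x y) m u"
  shows "negative_family (\<lambda>x. Re (B x x)) m u"
  unfolding negative_family_def
  using orthonormal_norm[OF hermitian_form_uminus[OF B] u] sum_cmod_square_pos
  by (metis (no_types, lifting) Re_complex_of_real minus_complex.simps(1) neg_0_less_iff_less uminus_complex.simps(1))

text \<open>For mutually singular \<open>N\<close> and \<open>P\<close>, every vector can be replaced by one that agrees with it up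
  to \<open>\<epsilon>\<close> for \<open>N\<close> and is \<open>\<epsilon>\<close>-small for \<open>P\<close>.\<close>

lemma singular_negative_family:
  assumes S: "hermitian_form S" and SN: "\<And>x. Re (S x x) = N x"
    and N: "pos_form N" and P: "pos_form (\<lambda>x. N x + b x)"
    and sing: "\<And>x. parallel_sum N (\<lambda>x. N x + b x) x = 0" and u: "orthonormal S m u"
  obtains y where "negative_family b m y"
proof -
  \<comment> \<open>The factor \<open>2 ^ m\<close> cancels the one in
    \<open>pos_form_sum_le\<close>, which leaves errors of at most C / 8 for a whole
    combination.\<close>
  define e :: real where "e = 1 / (8 * 2 ^ m)"
  have e: "0 < e" "2 ^ m * e = 1 / 8" by (simp_all add: e_def)
  have "\<exists>y. N (x - y) + (N y + b y) < e" for x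
    using parallel_sum_less[OF N P] sing e by simp
  then obtain y where y: "\<And>i. N (u i - y i) + (N (y i) + b (y i)) < e"
    using choice[of "\<lambda>i y. N (u i - y) + (N y + b y) < e"] by blast
  have Ny: "N (u i - y i) \<le> e" "N (y i) + b (y i) \<le> e" for i
    using y[of i] N P by (auto simp: pos_form_def) (smt (verit))+
  have "b (\<Sum>i<m. c i *s y i) < 0" if "\<exists>i<m. c i \<noteq> 0" for c
  proof -
    define C where "C = (\<Sum>i<m. (cmod (c i))\<^sup>2)"
    have C: "0 < C" unfolding C_def by (rule sum_cmod_square_pos[OF that])
    have small: "Q (\<Sum>i<m. c i *s z i) \<le> C / 8" if Q: "pos_form Q" and z: "\<And>i. Q (z i) \<le> e" for Q z
    proof -
      have "Q (\<Sum>i<m. c i *s z i) \<le> 2 ^ m * (\<Sum>i<m. Q (c i *s z i))"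
        by (rule pos_form_sum_le[OF Q])
      also have "(\<Sum>i<m. Q (c i *s z i)) \<le> (\<Sum>i<m. (cmod (c i))\<^sup>2 * e)"
        using Q z by (intro sum_mono) (auto simp: pos_form_def quad_form_scale intro!: mult_left_mono)
      also have "2 ^ m * (\<Sum>i<m. (cmod (c i))\<^sup>2 * e) = C * (2 ^ m * e)"
        by (simp add: C_def sum_distrib_right[symmetric])
      finally show ?thesis using e by simp
    qed
    let ?y = "\<Sum>i<m. c i *s y i"
    have "C = N (\<Sum>i<m. c i *s u i)"
      using SN[symmetric] orthonormal_norm[OF S u, of c] by (simp add: C_def)
    also have "(\<Sum>i<m. c i *s u i) = ?y + (\<Sum>i<m. c i *s (u i - y i))"
      by (simp add: scale_right_diff_distrib sum_subtractf)
    also have "N \<dots> \<le> 2 * N ?y + 2 * N (\<Sum>i<m. c i *s (u i - y i))"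
      by (rule pos_form_le[OF N])
    also have "N (\<Sum>i<m. c i *s (u i - y i)) \<le> C / 8" by (rule small[OF N Ny(1)])
    \<comment> \<open>Hence N is at least 3C/8 at the combination, while N + b is at most C/8 there,
      so b is at most -C/4.\<close>
    finally have "C \<le> 2 * N ?y + C / 4" by simp
    moreover have "N ?y + b ?y \<le> C / 8" by (rule small[OF P Ny(2)])
    ultimately show ?thesis using C by linarith
  qed
  then have "negative_family b m y" by (auto simp: negative_family_def)
  then show ?thesis by (rule that)
qed

text \<open>The orbit supremum of \<open>q\<close> is an equivalent invariant norm that is still uniformly convex, so
  minimizing sequences of it are Cauchy and asymptotically invariant.\<close>

lemma approximate_fixed_points:
  assumes q: "pos_form q" and C: "0 < C" and id: "id \<in> \<T>"
    and comp: "\<And>S T. S \<in> \<T> \<Longrightarrow> T \<in> \<T> \<Longrightarrow> S \<circ> T \<in> \<T>"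
    and add: "\<And>T x y. T \<in> \<T> \<Longrightarrow> T (x + y) = T x + T y"
    and scale: "\<And>T c x. T \<in> \<T> \<Longrightarrow> T (c *s x) = c *s T x"
    and le: "\<And>T x. T \<in> \<T> \<Longrightarrow> q (T x) \<le> C * q x"
    and ge: "\<And>T x. T \<in> \<T> \<Longrightarrow> q x \<le> C * q (T x)"
    and convex: "\<And>x y. x \<in> \<Delta> \<Longrightarrow> y \<in> \<Delta> \<Longrightarrow> (1/2) *s (x + y) \<in> \<Delta>"
    and inv: "\<And>T x. T \<in> \<T> \<Longrightarrow> x \<in> \<Delta> \<Longrightarrow> T x \<in> \<Delta>" and "z \<in> \<Delta>"
  obtains l :: "nat \<Rightarrow> 'v" where "\<And>n. l n \<in> \<Delta>"
    "\<And>T e. T \<in> \<T> \<Longrightarrow> 0 < e \<Longrightarrow> \<exists>k. \<forall>n\<ge>k. \<forall>m\<ge>k. q (T (l n) - l m) < e"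
proof -
  define f where "f x = (SUP T\<in>\<T>. q (T x))" for x
  define I where "I = (INF x\<in>\<Delta>. f x)"
  have qf: "quad_form q" and q0: "\<And>x. 0 \<le> q x" using q by (auto simp: pos_form_def)
  have upper: "q (T x) \<le> f x" if "T \<in> \<T>" for T x
    unfolding f_def by (rule cSUP_upper[OF that]) (rule bdd_aboveI2, rule le)
  have f0: "0 \<le> f x" for x using upper[OF id, of x] q0[of x] by simp
  have f_T: "f (T x) \<le> f x" if "T \<in> \<T>" for T x
    unfolding f_def[of "T x"]
  proof (rule cSUP_least)
    fix S assume "S \<in> \<T>"
    then show "q (S (T x)) \<le> f x" using upper[OF comp[OF _ that], of S x] by simp
  qed (use id in blast)
  have I_le: "I \<le> f x" if "x \<in> \<Delta>" for x
    unfolding I_def by (rule cINF_lower[OF _ that]) (rule bdd_belowI2[of _ 0], rule f0)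
  \<comment> \<open>\<open>T\<close> nearly attains the supremum at the midpoint \<open>w\<close>.
    The parallelogram law then gives 2(I+e) + 2(I+e) - 4(I-e) = 8e as a bound for T x - T y, and
    \<open>ge\<close> carries it back to x - y at the cost of C.\<close>
  have near: "q (x - y) \<le> C * (8 * e)"
    if "0 < e" "x \<in> \<Delta>" "y \<in> \<Delta>" "f x \<le> I + e" "f y \<le> I + e" for x y e
  proof -
    define w where "w = (1/2) *s (x + y)"
    have "I - e < f w" using I_le[OF convex[OF that(2,3)]] \<open>0 < e\<close> by (simp add: w_def)
    then obtain T where T: "T \<in> \<T>" "I - e < q (T w)"
      unfolding f_def by (subst (asm) less_cSUP_iff) (use id le in \<open>auto intro!: bdd_aboveI2\<close>)
    have "x + y = 2 *s w" by (simp add: w_def)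
    then have xy: "q (T x + T y) = 4 * q (T w)"
      using quad_form_scale[OF qf, of 2 "T w"] by (simp add: add[OF T(1), symmetric] scale[OF T(1)])
    have diff: "T (x - y) = T x - T y"
      using add[OF T(1), of "x - y" y] by (simp add: algebra_simps)
    have "q (x - y) \<le> C * q (T x - T y)" using ge[OF T(1), of "x - y"] by (simp add: diff)
    also have "q (T x - T y) \<le> 8 * e"
      using quad_form_parallelogram[OF qf, of "T x" "T y"] xy T(2) upper[OF T(1), of x]
        upper[OF T(1), of y] that(4,5) by linarith
    finally show ?thesis using C by simp
  qed
  have "\<exists>x\<in>\<Delta>. f x < I + 1 / real (Suc n)" for n
  proof -
    have "I < I + 1 / real (Suc n)" by simp
    then show ?thesis
      unfolding I_def by (subst (asm) cINF_less_iff) (use \<open>z \<in> \<Delta>\<close> f0 in \<open>auto intro!: bdd_belowI2\<close>)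
  qed
  then obtain l where l: "\<And>n. l n \<in> \<Delta>" "\<And>n. f (l n) < I + 1 / real (Suc n)" by metis
  have "\<exists>k. \<forall>n\<ge>k. \<forall>m\<ge>k. q (T (l n) - l m) < e" if T: "T \<in> \<T>" and "0 < e" for T e
  proof -
    \<comment> \<open>With this d the bound \<open>C * (8 * d)\<close> equals e / 2.\<close>
    define d where "d = e / (16 * C)"
    have d: "0 < d" "C * (8 * d) < e" using \<open>0 < e\<close> C by (simp_all add: d_def)
    obtain k where k: "1 / real (Suc k) < d" using d(1) by (rule nat_approx_posE)
    have fl: "f (l n) \<le> I + d" if "k \<le> n" for n
    proof -
      have "1 / real (Suc n) \<le> 1 / real (Suc k)" using that by (simp add: frac_le)
      then show ?thesis using l(2)[of n] k by linarith
    qed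
    have "q (T (l n) - l m) < e" if "k \<le> n" "k \<le> m" for n m
    proof -
      \<comment> \<open>\<open>T (l n)\<close> is again a near-minimizer, so \<open>near\<close>
        compares it with \<open>l m\<close>. This one estimate contains the asymptotic invariance
        and, for T = id, the Cauchy property.\<close>
      have "f (T (l n)) \<le> I + d" using f_T[OF T, of "l n"] fl[OF that(1)] by linarith
      from near[OF d(1) inv[OF T l(1)] l(1) this fl[OF that(2)]] d(2) show ?thesis by linarith
    qed
    then show ?thesis by blast
  qed
  then show ?thesis using that l(1) by blast
qed

end

section \<open>Positive semidefinite kernels\<close>

definition kernel_sum :: "'i set \<Rightarrow> ('i \<Rightarrow> 'i \<Rightarrow> complex) \<Rightarrow> ('i \<Rightarrow> complex) \<Rightarrow> complex" where
  "kernel_sum A K c = (\<Sum>a\<in>A. \<Sum>b\<in>A. c a * cnj (c b) * K a b)"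

definition psd_on :: "'i set \<Rightarrow> ('i \<Rightarrow> 'i \<Rightarrow> complex) \<Rightarrow> bool" where
  "psd_on A K \<longleftrightarrow> (\<forall>a\<in>A. \<forall>b\<in>A. K b a = cnj (K a b)) \<and> (\<forall>c. 0 \<le> Re (kernel_sum A K c))"

lemma psd_onI:
  assumes "\<And>a b. a \<in> A \<Longrightarrow> b \<in> A \<Longrightarrow> K b a = cnj (K a b)" "\<And>c. 0 \<le> Re (kernel_sum A K c)"
  shows "psd_on A K"
  unfolding psd_on_def using assms by blast

lemma psd_on_commute: "psd_on A K \<Longrightarrow> a \<in> A \<Longrightarrow> b \<in> A \<Longrightarrow> K b a = cnj (K a b)"
  unfolding psd_on_def by blast

lemma psd_on_nonneg: "psd_on A K \<Longrightarrow> 0 \<le> Re (kernel_sum A K c)"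
  unfolding psd_on_def by blast

lemma kernel_sum_add: "kernel_sum A (\<lambda>a b. K a b + L a b) c = kernel_sum A K c + kernel_sum A L c"
  by (simp add: kernel_sum_def distrib_left sum.distrib)

lemma psd_on_add:
  assumes "psd_on A K" "psd_on A L" shows "psd_on A (\<lambda>a b. K a b + L a b)"
proof (rule psd_onI)
  show "K b a + L b a = cnj (K a b + L a b)" if "a \<in> A" "b \<in> A" for a b
    using psd_on_commute[OF assms(1) that] psd_on_commute[OF assms(2) that] by simp
qed (simp add: kernel_sum_add psd_on_nonneg assms)

lemma psd_on_cnj:
  assumes "psd_on A K" shows "psd_on A (\<lambda>a b. cnj (K a b))"
proof -
  have "kernel_sum A (\<lambda>a b. cnj (K a b)) c = cnj (kernel_sum A K (\<lambda>a. cnj (c a)))" for c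
    by (simp add: kernel_sum_def)
  then show ?thesis
    using psd_on_nonneg[OF assms] by (intro psd_onI) (simp_all, metis psd_on_commute[OF assms])
qed

text \<open>A quadratic polynomial in the new coefficient t; minimizing it over t produces the Schur
  complement in \<open>psd_on_Gram\<close>.\<close>

lemma kernel_sum_insert:
  assumes "finite A" "a0 \<notin> A" and herm: "\<And>a. a \<in> A \<Longrightarrow> K a0 a = cnj (K a a0)"
  shows "kernel_sum (insert a0 A) K (c(a0 := t)) =
    kernel_sum A K c + cnj t * (\<Sum>a\<in>A. c a * K a a0) + t * cnj (\<Sum>a\<in>A. c a * K a a0) + t * cnj t * K a0 a0"
proof -
  define d where "d = c(a0 := t)"
  have d: "d a0 = t" "\<And>a. a \<in> A \<Longrightarrow> d a = c a" using \<open>a0 \<notin> A\<close> by (auto simp: d_def)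
  have "kernel_sum (insert a0 A) K d =
    (d a0 * cnj (d a0) * K a0 a0 + (\<Sum>b\<in>A. d a0 * cnj (d b) * K a0 b)) +
    (\<Sum>a\<in>A. d a * cnj (d a0) * K a a0 + (\<Sum>b\<in>A. d a * cnj (d b) * K a b))"
    using assms(1,2) by (simp add: kernel_sum_def)
  also have "(\<Sum>b\<in>A. d a0 * cnj (d b) * K a0 b) = t * cnj (\<Sum>a\<in>A. c a * K a a0)"
    unfolding cnj_sum sum_distrib_left by (rule sum.cong) (simp_all add: d herm)
  also have "(\<Sum>a\<in>A. d a * cnj (d a0) * K a a0 + (\<Sum>b\<in>A. d a * cnj (d b) * K a b))
      = cnj t * (\<Sum>a\<in>A. c a * K a a0) + kernel_sum A K c"
    unfolding kernel_sum_def sum_distrib_left sum.distrib[symmetric]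
    by (rule sum.cong) (simp_all add: d cong: sum.cong)
  finally show ?thesis unfolding d_def[symmetric] by (simp add: d(1) algebra_simps)
qed

text \<open>Cholesky factorization: split off the rank-one kernel given by the row of
  \<open>a0\<close>. What is left on A is the Schur complement, which is again positive
  semidefinite.\<close>

lemma psd_on_Gram:
  assumes "finite A" "psd_on A K"
  shows "\<exists>n v. \<forall>a\<in>A. \<forall>b\<in>A. K a b = (\<Sum>k<(n::nat). v k a * cnj (v k b))"
  using assms
proof (induction A arbitrary: K rule: finite_induct)
  case empty
  then show ?case by simp
next
  case (insert a0 A)
  have herm: "K b a = cnj (K a b)" if "a \<in> insert a0 A" "b \<in> insert a0 A" for a b
    by (rule psd_on_commute[OF insert.prems that])
  define d where "d = Re (K a0 a0)"
  have K00: "K a0 a0 = of_real d"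
    using arg_cong[OF herm[of a0 a0], of Im] by (simp add: d_def complex_eq_iff)
  have nn: "0 \<le> Re (kernel_sum A K c + cnj t * (\<Sum>a\<in>A. c a * K a a0)
      + t * cnj (\<Sum>a\<in>A. c a * K a a0) + t * cnj t * of_real d)" for c t
    using psd_on_nonneg[OF insert.prems, of "c(a0 := t)"]
    by (subst (asm) kernel_sum_insert[OF insert.hyps herm]) (simp_all add: K00)
  have d0: "0 \<le> d" using nn[of "\<lambda>_. 0" 1] by (simp add: kernel_sum_def)
  \<comment> \<open>A zero pivot forces a zero row, since otherwise a large multiple of
    \<open>a0\<close> would make the form negative; the t below makes its value -1.\<close>
  have row: "K a a0 = 0" if "d = 0" "a \<in> A" for a
  proof (rule ccontr)
    assume nz: "K a a0 \<noteq> 0"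
    define t where "t = (Re (K a a) + 1) / (2 * (cmod (K a a0))\<^sup>2)"
    have c: "(\<Sum>x\<in>A. of_bool (x = a) * F x) = F a" for F :: "_ \<Rightarrow> complex"
      using \<open>a \<in> A\<close> insert.hyps(1) by (simp add: of_bool_def if_distrib[of "\<lambda>x. x * _"] cong: if_cong)
    have "kernel_sum A K (\<lambda>x. of_bool (x = a)) =
        (\<Sum>x\<in>A. of_bool (x = a) * (\<Sum>b\<in>A. of_bool (b = a) * K x b))"
      by (auto simp: kernel_sum_def mult.assoc sum_distrib_left of_bool_def intro!: sum.cong)
    then have ks: "kernel_sum A K (\<lambda>x. of_bool (x = a)) = K a a" unfolding c .
    have "0 \<le> Re (K a a + cnj (- of_real t * K a a0) * K a a0 + (- of_real t * K a a0) * cnj (K a a0))"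
      using nn[of "\<lambda>x. of_bool (x = a)" "- of_real t * K a a0"] \<open>d = 0\<close> unfolding ks c by simp
    also have "\<dots> = Re (K a a) - 2 * t * (cmod (K a a0))\<^sup>2"
      unfolding cmod_power2 by (simp add: algebra_simps power2_eq_square)
    also have "\<dots> = - 1" using nz by (simp add: t_def field_simps)
    finally show False by simp
  qed
  \<comment> \<open>For d = 0 division by zero yields 0, so \<open>L\<close> is then K itself, in
    agreement with the vanishing row.\<close>
  define L where "L a b = K a b - K a a0 * K a0 b / of_real d" for a b
  have "psd_on A L"
  proof (rule psd_onI)
    fix a b assume "a \<in> A" "b \<in> A"
    then show "L b a = cnj (L a b)"
      using herm[of a b] herm[of a a0] herm[of a0 b] by (simp add: L_def)
  next
    fix c
    define s where "s = (\<Sum>a\<in>A. c a * K a a0)"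
    have "kernel_sum A L c = kernel_sum A K c - (\<Sum>a\<in>A. \<Sum>b\<in>A. (c a * K a a0) * cnj (c b * K b a0)) / of_real d"
      using herm[of _ a0] by (simp add: kernel_sum_def L_def right_diff_distrib sum_subtractf sum_divide_distrib ac_simps)
    also have "(\<Sum>a\<in>A. \<Sum>b\<in>A. (c a * K a a0) * cnj (c b * K b a0)) = s * cnj s"
      unfolding s_def cnj_sum sum_product ..
    finally have L: "kernel_sum A L c = kernel_sum A K c - s * cnj s / of_real d" .
    show "0 \<le> Re (kernel_sum A L c)"
    proof (cases "d = 0")
      case True
      then show ?thesis using nn[of c 0] L by simp
    next
      case False
      \<comment> \<open>The coefficient -s / d at \<open>a0\<close> minimizes the polynomial, and
        the minimum is the kernel sum of \<open>L\<close>.\<close>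
      have "kernel_sum A L c = kernel_sum A K c + cnj (- s / of_real d) * s + (- s / of_real d) * cnj s
          + (- s / of_real d) * cnj (- s / of_real d) * of_real d"
        unfolding L using False by (simp add: field_simps)
      then show ?thesis using nn[of c "- s / of_real d"] by (simp add: s_def)
    qed
  qed
  then obtain n v where v: "\<And>a b. a \<in> A \<Longrightarrow> b \<in> A \<Longrightarrow> L a b = (\<Sum>k<(n::nat). v k a * cnj (v k b))"
    using insert.IH by blast
  \<comment> \<open>The new vector gets index n. The old ones are set to 0 at \<open>a0\<close>,
    about which the induction hypothesis says nothing.\<close>
  define v' where "v' k a = (if k = n then K a a0 / of_real (sqrt d) else if a = a0 then 0 else v k a)" for k a
  have "(\<Sum>k<Suc n. v' k a * cnj (v' k b)) = K a b" if ab: "a \<in> insert a0 A" "b \<in> insert a0 A" for a b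
  proof -
    have row': "K x a0 = 0" "K a0 x = 0" if "d = 0" "x \<in> insert a0 A" for x
      using row[of x] K00 that herm[of x a0] by auto
    have "(\<Sum>k<n. v' k a * cnj (v' k b)) = L a b"
    proof (cases "a = a0 \<or> b = a0")
      case True
      then have "L a b = 0" using K00 row'[OF _ ab(1)] row'[OF _ ab(2)] by (cases "d = 0") (auto simp: L_def)
      then show ?thesis using True by (auto simp: v'_def)
    next
      case False
      then show ?thesis using v[of a b] ab by (simp add: v'_def)
    qed
    moreover have "v' n a * cnj (v' n b) = K a a0 * K a0 b / of_real d"
      using d0 herm[OF ab(2), of a0] by (simp add: v'_def flip: of_real_mult)
    ultimately show ?thesis by (simp add: L_def)
  qed
  then show ?case by (intro exI[of _ "Suc n"] exI[of _ v'] ballI) (rule sym)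
qed

text \<open>A Gram representation of K writes the form of the product as a sum of forms of L with
  coefficients rescaled by \<open>v k\<close>.\<close>

theorem Schur_product:
  assumes "finite A" and K: "psd_on A K" and L: "psd_on A L"
  shows "psd_on A (\<lambda>a b. K a b * L a b)"
proof (rule psd_onI)
  fix a b assume "a \<in> A" "b \<in> A"
  then have "K b a = cnj (K a b)" "L b a = cnj (L a b)"
    using psd_on_commute[OF K] psd_on_commute[OF L] by blast+
  then show "K b a * L b a = cnj (K a b * L a b)" by simp
next
  fix c
  obtain n v where v: "\<forall>a\<in>A. \<forall>b\<in>A. K a b = (\<Sum>k<(n::nat). v k a * cnj (v k b))"
    using psd_on_Gram[OF assms(1) K] by blast
  have "kernel_sum A (\<lambda>a b. K a b * L a b) c
      = (\<Sum>a\<in>A. \<Sum>b\<in>A. \<Sum>k<n. (c a * v k a) * cnj (c b * v k b) * L a b)"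
    unfolding kernel_sum_def by (intro sum.cong) (simp_all add: v sum_distrib_left sum_distrib_right ac_simps)
  also have "\<dots> = (\<Sum>a\<in>A. \<Sum>k<n. \<Sum>b\<in>A. (c a * v k a) * cnj (c b * v k b) * L a b)"
    by (intro sum.cong refl sum.swap)
  also have "\<dots> = (\<Sum>k<n. kernel_sum A L (\<lambda>a. c a * v k a))"
    unfolding kernel_sum_def by (rule sum.swap)
  finally show "0 \<le> Re (kernel_sum A (\<lambda>a b. K a b * L a b) c)"
    using psd_on_nonneg[OF L] by (auto intro: sum_nonneg)
qed

text \<open>The difference |K'|^2 - |K|^2 equals (K' - K) cnj K' + K cnj (K' - K), a sum of Schur
  products of positive semidefinite kernels.\<close>

lemma kernel_sum_cmod_square_mono:
  assumes A: "finite A" and K: "psd_on A K" and L: "psd_on A (\<lambda>a b. K' a b - K a b)"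
  shows "Re (kernel_sum A (\<lambda>a b. of_real ((cmod (K a b))\<^sup>2)) c)
    \<le> Re (kernel_sum A (\<lambda>a b. of_real ((cmod (K' a b))\<^sup>2)) c)"
proof -
  have K': "psd_on A K'" using psd_on_add[OF K L] by simp
  define M where "M a b = (K' a b - K a b) * cnj (K' a b) + K a b * cnj (K' a b - K a b)" for a b
  have "psd_on A M"
    unfolding M_def by (intro psd_on_add Schur_product A K L psd_on_cnj K')
  then have "0 \<le> Re (kernel_sum A M c)" by (rule psd_on_nonneg)
  moreover have "(\<lambda>a b. of_real ((cmod (K' a b))\<^sup>2)) = (\<lambda>a b. of_real ((cmod (K a b))\<^sup>2) + M a b)"
    unfolding complex_norm_square M_def by (simp add: algebra_simps)
  ultimately show ?thesis by (simp only: kernel_sum_add) simp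
qed

lemma (in complex_vector_space) psd_on_hermitian_form:
  assumes S: "hermitian_form S" and nn: "\<And>x. 0 \<le> Re (S x x)"
  shows "psd_on A (\<lambda>a b. S (w a) (w b))"
proof -
  have "kernel_sum A (\<lambda>a b. S (w a) (w b)) c = S (\<Sum>a\<in>A. c a *s w a) (\<Sum>a\<in>A. c a *s w a)" for c
    by (simp add: kernel_sum_def hermitian_form_simps[OF S] sum_distrib_left mult.assoc)
      (subst sum.swap, simp add: ac_simps)
  then show ?thesis using nn by (intro psd_onI hermitian_form_commute[OF S]) simp
qed

section \<open>The free complex vector space\<close>

abbreviation coeff_at :: "('a \<Rightarrow>\<^sub>0 complex) \<Rightarrow> 'a \<Rightarrow> complex" where
  "coeff_at \<equiv> Poly_Mapping.lookup"

definition smul :: "complex \<Rightarrow> ('a \<Rightarrow>\<^sub>0 complex) \<Rightarrow> 'a \<Rightarrow>\<^sub>0 complex" where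
  "smul c x = Poly_Mapping.map ((*) c) x"

lemma lookup_smul [simp]: "coeff_at (smul c x) a = c * coeff_at x a"
  by (simp add: smul_def Poly_Mapping.map.rep_eq when_def)

interpretation free: complex_vector_space smul
  by unfold_locales (rule poly_mapping_eqI, simp add: lookup_add algebra_simps)+

definition lin_ext :: "('a \<Rightarrow> complex) \<Rightarrow> ('a \<Rightarrow>\<^sub>0 complex) \<Rightarrow> complex" where
  "lin_ext w x = (\<Sum>a\<in>Poly_Mapping.keys x. coeff_at x a * w a)"

lemma lin_ext_superset:
  "finite A \<Longrightarrow> Poly_Mapping.keys x \<subseteq> A \<Longrightarrow> lin_ext w x = (\<Sum>a\<in>A. coeff_at x a * w a)"
  unfolding lin_ext_def by (rule sum.mono_neutral_left) (auto simp: in_keys_iff)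

lemma lin_ext_add: "lin_ext w (x + y) = lin_ext w x + lin_ext w y"
proof -
  let ?A = "Poly_Mapping.keys x \<union> Poly_Mapping.keys y"
  have "lin_ext w z = (\<Sum>a\<in>?A. coeff_at z a * w a)" if "z \<in> {x, y, x + y}" for z
    by (rule lin_ext_superset) (use that Poly_Mapping.keys_add[of x y] in auto)
  then show ?thesis by (simp add: lookup_add distrib_right sum.distrib)
qed

lemma lin_ext_smul: "lin_ext w (smul c x) = c * lin_ext w x"
proof -
  have "lin_ext w (smul c x) = (\<Sum>a\<in>Poly_Mapping.keys x. coeff_at (smul c x) a * w a)"
    by (rule lin_ext_superset) (auto simp: in_keys_iff)
  then show ?thesis by (simp add: lin_ext_def sum_distrib_left mult.assoc)
qed

lemma lin_ext_diff: "lin_ext w (x - y) = lin_ext w x - lin_ext w y"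
  using lin_ext_add[of w "x - y" y] by simp

lemma lin_ext_single [simp]: "lin_ext w (Poly_Mapping.single a c) = c * w a"
  by (simp add: lin_ext_def)

text \<open>Nesting \<open>lin_ext\<close> makes linearity in the first argument immediate; the two
  conjugations make the second argument conjugate linear.\<close>

definition kernel_form ::
  "('a \<Rightarrow> 'a \<Rightarrow> complex) \<Rightarrow> ('a \<Rightarrow>\<^sub>0 complex) \<Rightarrow> ('a \<Rightarrow>\<^sub>0 complex) \<Rightarrow> complex" where
  "kernel_form K x y = lin_ext (\<lambda>a. cnj (lin_ext (\<lambda>b. cnj (K a b)) y)) x"

lemma kernel_form_sum: "kernel_form K x y =
  (\<Sum>a\<in>Poly_Mapping.keys x. \<Sum>b\<in>Poly_Mapping.keys y. coeff_at x a * cnj (coeff_at y b) * K a b)"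
  by (simp add: kernel_form_def lin_ext_def sum_distrib_left mult.assoc)

lemma kernel_form_single [simp]:
  "kernel_form K (Poly_Mapping.single a 1) (Poly_Mapping.single b 1) = K a b"
  by (simp add: kernel_form_def)

lemma hermitian_kernel_form:
  assumes "\<And>a b. K b a = cnj (K a b)"
  shows "free.hermitian_form (kernel_form K)"
proof (rule free.hermitian_formI)
  fix x y :: "'a \<Rightarrow>\<^sub>0 complex"
  have "cnj (kernel_form K x y) =
    (\<Sum>a\<in>Poly_Mapping.keys x. \<Sum>b\<in>Poly_Mapping.keys y. coeff_at y b * cnj (coeff_at x a) * K b a)"
    unfolding kernel_form_sum by (simp add: assms[symmetric] ac_simps)
  also have "\<dots> = kernel_form K y x" unfolding kernel_form_sum by (rule sum.swap)
  finally show "kernel_form K y x = cnj (kernel_form K x y)" by simp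
qed (simp_all add: kernel_form_def lin_ext_add lin_ext_smul)

lemma kernel_form_rank_one:
  "kernel_form (\<lambda>a b. w a * cnj (w b)) x x = of_real ((cmod (lin_ext w x))\<^sup>2)"
  unfolding complex_norm_square kernel_form_sum lin_ext_def cnj_sum sum_product
  by (intro sum.cong) (simp_all add: ac_simps)

text \<open>Since \<open>G\<close> need not exhaust its type, translations fix all points outside the carrier.\<close>

definition (in group) shift :: "'a \<Rightarrow> 'a \<Rightarrow> 'a" where
  "shift s t = (if t \<in> carrier G then s \<otimes> t else t)"

definition (in group) translate :: "'a \<Rightarrow> ('a \<Rightarrow>\<^sub>0 complex) \<Rightarrow> 'a \<Rightarrow>\<^sub>0 complex" where
  "translate s x = Poly_Mapping.map_key (shift (inv s)) x"

context group
begin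

lemma shift_inv:
  "s \<in> carrier G \<Longrightarrow> shift (inv s) (shift s t) = t"
  "s \<in> carrier G \<Longrightarrow> shift s (shift (inv s) t) = t"
proof -
  assume s: "s \<in> carrier G"
  have "inv s \<otimes> (s \<otimes> t) = t" "s \<otimes> (inv s \<otimes> t) = t" if "t \<in> carrier G"
    using s that m_assoc[of "inv s" s t] m_assoc[of s "inv s" t] by simp_all
  then show "shift (inv s) (shift s t) = t" "shift s (shift (inv s) t) = t"
    using s by (simp_all add: shift_def)
qed

lemma inj_shift: "s \<in> carrier G \<Longrightarrow> inj (shift s)"
  by (metis injI shift_inv(1))

lemma lookup_translate: "s \<in> carrier G \<Longrightarrow> coeff_at (translate s x) t = coeff_at x (shift (inv s) t)"
  by (simp add: translate_def map_key.rep_eq inj_shift)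

lemma translate_mult:
  "s \<in> carrier G \<Longrightarrow> t \<in> carrier G \<Longrightarrow> translate (s \<otimes> t) x = translate s (translate t x)"
  by (rule poly_mapping_eqI) (simp add: lookup_translate, simp add: shift_def inv_mult_group m_assoc)

lemma translate_one: "translate \<one> x = x"
  by (rule poly_mapping_eqI) (simp add: lookup_translate shift_def)

lemma translate_add: "s \<in> carrier G \<Longrightarrow> translate s (x + y) = translate s x + translate s y"
  by (rule poly_mapping_eqI) (simp add: lookup_translate lookup_add)

lemma translate_smul: "s \<in> carrier G \<Longrightarrow> translate s (smul c x) = smul c (translate s x)"
  by (rule poly_mapping_eqI) (simp add: lookup_translate)

lemma keys_translate:
  assumes "s \<in> carrier G"
  shows "Poly_Mapping.keys (translate s x) = shift s ` Poly_Mapping.keys x"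
proof (intro equalityI subsetI)
  fix t assume "t \<in> Poly_Mapping.keys (translate s x)"
  then have "shift (inv s) t \<in> Poly_Mapping.keys x"
    using assms by (simp add: in_keys_iff lookup_translate)
  then show "t \<in> shift s ` Poly_Mapping.keys x"
    by (rule image_eqI[rotated]) (simp add: shift_inv assms)
qed (auto simp: in_keys_iff lookup_translate shift_inv assms)

lemma lin_ext_translate:
  assumes "s \<in> carrier G"
  shows "lin_ext w (translate s x) = lin_ext (\<lambda>a. w (shift s a)) x"
  unfolding lin_ext_def keys_translate[OF assms]
  by (subst sum.reindex) (auto simp: lookup_translate assms shift_inv inj_on_subset[OF inj_shift])

lemma kernel_form_translate:
  "s \<in> carrier G \<Longrightarrow> kernel_form K (translate s x) (translate s y) = kernel_form (\<lambda>a b. K (shift s a) (shift s b)) x y"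
  by (simp add: kernel_form_def lin_ext_translate)

lemma translate_single:
  assumes "s \<in> carrier G" "a \<in> carrier G"
  shows "translate s (Poly_Mapping.single a c) = Poly_Mapping.single (s \<otimes> a) c"
proof -
  have "shift (inv s) t = a \<longleftrightarrow> s \<otimes> a = t" for t
    using assms shift_inv(2)[OF assms(1), of t] shift_inv(1)[OF assms(1), of a] by (auto simp: shift_def)
  then show ?thesis
    by (intro poly_mapping_eqI) (simp add: lookup_translate assms lookup_single when_def eq_commute)
qed

end

section \<open>An invariant bound for the negative part\<close>

text \<open>The form may be indefinite: the locale serves B itself and also the two positive
  invariant forms obtained at the end.\<close>

locale form_representation = complex_vector_space scale + group G
  for scale :: "complex \<Rightarrow> 'v::ab_group_add \<Rightarrow> 'v" (infixr \<open>*s\<close> 75)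
    and G :: "('a, 'b) monoid_scheme" (structure) +
  fixes T :: "'a \<Rightarrow> 'v \<Rightarrow> 'v" and B :: "'v \<Rightarrow> 'v \<Rightarrow> complex"
  assumes T_add: "s \<in> carrier G \<Longrightarrow> T s (x + y) = T s x + T s y"
    and T_scale: "s \<in> carrier G \<Longrightarrow> T s (c *s x) = c *s T s x"
    and T_mult: "s \<in> carrier G \<Longrightarrow> t \<in> carrier G \<Longrightarrow> T (s \<otimes> t) x = T s (T t x)"
    and T_one: "T \<one> x = x"
    and B: "hermitian_form B"
    and B_invariant: "s \<in> carrier G \<Longrightarrow> B (T s x) (T s y) = B x y"
begin

lemma T_inv: "s \<in> carrier G \<Longrightarrow> T (inv s) (T s x) = x" "s \<in> carrier G \<Longrightarrow> T s (T (inv s) x) = x"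
  by (simp_all add: T_mult[symmetric] T_one)

lemma T_diff: "s \<in> carrier G \<Longrightarrow> T s (x - y) = T s x - T s y"
  using T_add[of s "x - y" y] by (simp add: algebra_simps)

lemma T_zero: "s \<in> carrier G \<Longrightarrow> T s 0 = 0"
  using T_scale[of s 0 0] by simp

lemma surj_T: "s \<in> carrier G \<Longrightarrow> surj (T s)"
  by (metis T_inv(2) surjI)

lemma B_adjoint: "s \<in> carrier G \<Longrightarrow> B (T s x) y = B x (T (inv s) y)"
  using B_invariant[of "inv s" "T s x" y] by (simp add: T_inv)

lemma B_adjoint': "s \<in> carrier G \<Longrightarrow> B x (T s y) = B (T (inv s) x) y"
  using B_invariant[of "inv s" x "T s y"] by (simp add: T_inv)

end

text \<open>\<open>B_bounded\<close> is a pointwise hypothesis whose bound depends on x and y;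
  \<open>H_translate_le\<close> upgrades it to a uniform one.\<close>

locale bounded_quasi_definite_representation = form_representation scale G T B
  for scale :: "complex \<Rightarrow> 'v::ab_group_add \<Rightarrow> 'v" (infixr \<open>*s\<close> 75)
    and G :: "('a, 'b) monoid_scheme" (structure)
    and T :: "'a \<Rightarrow> 'v \<Rightarrow> 'v" and B :: "'v \<Rightarrow> 'v \<Rightarrow> complex" +
  fixes m :: nat and e :: "nat \<Rightarrow> 'v"
  assumes B_bounded: "\<exists>M. \<forall>s\<in>carrier G. cmod (B (T s x) y) \<le> M"
    and e: "orthonormal (\<lambda>x y. - B x y) m e"
    and e_max: "\<not> orthonormal (\<lambda>x y. - B x y) (Suc m) e'"
begin

text \<open>\<open>NF\<close> is minus the part of \<open>B\<close> on the span of \<open>e\<close>, and \<open>H\<close> is the positive form obtained from \<open>B\<close>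
  by reversing its sign there.\<close>

definition b where "b x = Re (B x x)"
definition N0 where "N0 x = (\<Sum>i<m. (cmod (B x (e i)))\<^sup>2)"
definition NF where "NF x y = (\<Sum>i<m. B x (e i) * B (e i) y)"
definition H where "H x y = B x y + 2 * NF x y"

lemma quad_b: "quad_form b"
  unfolding b_def by (rule quad_form_Re_hermitian_form[OF B])

lemma b_invariant: "s \<in> carrier G \<Longrightarrow> b (T s x) = b x"
  by (simp add: b_def B_invariant)

lemma hermitian_NF: "hermitian_form NF"
proof (rule hermitian_formI)
  show "NF y x = cnj (NF x y)" for x y
    unfolding NF_def cnj_sum complex_cnj_mult
    by (rule sum.cong[OF refl]) (subst mult.commute, simp flip: hermitian_form_commute[OF B])
qed (simp_all add: NF_def hermitian_form_simps[OF B] sum.distrib distrib_right sum_distrib_left mult.assoc)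

lemma NF_self: "NF x x = of_real (N0 x)"
  unfolding NF_def N0_def of_real_sum complex_norm_square
  by (rule sum.cong[OF refl]) (simp flip: hermitian_form_commute[OF B])

lemma N0_nonneg: "0 \<le> N0 x"
  by (simp add: N0_def sum_nonneg)

lemma quad_N0: "quad_form N0"
  using quad_form_Re_hermitian_form[OF hermitian_NF] by (simp add: NF_self)

lemma P0_nonneg: "0 \<le> b x + N0 x"
  using maximal_orthonormal_norm_le(1)[OF hermitian_form_uminus[OF B] e e_max, of x] by (simp add: b_def N0_def)

lemma hermitian_form_combine:
  assumes "hermitian_form S" "hermitian_form S'"
  shows "hermitian_form (\<lambda>x y. of_real r * S x y + of_real t * S' x y)"
proof (rule hermitian_formI)
  show "of_real r * S y x + of_real t * S' y x = cnj (of_real r * S x y + of_real t * S' x y)" for x y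
    by (simp flip: hermitian_form_commute[OF assms(1)] hermitian_form_commute[OF assms(2)])
qed (simp_all add: hermitian_form_simps[OF assms(1)] hermitian_form_simps[OF assms(2)] algebra_simps)

lemma hermitian_H: "hermitian_form H"
  using hermitian_form_combine[OF B hermitian_NF, of 1 2] by (simp add: H_def[abs_def])

lemma H_self: "Re (H x x) = b x + 2 * N0 x"
  by (simp add: H_def b_def NF_self)

lemma H_nonneg: "0 \<le> Re (H x x)"
  using P0_nonneg[of x] N0_nonneg[of x] by (simp add: H_self)

text \<open>B is the difference of the positive forms B + NF and NF, both below H. Cauchy-Schwarz
  for each of them gives |B| \<le> 2r.\<close>

lemma B_le_H: "(cmod (B x y))\<^sup>2 \<le> 4 * Re (H x x) * Re (H y y)"
proof -
  define P where "P x y = B x y + NF x y" for x y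
  have P: "hermitian_form P"
    using hermitian_form_combine[OF B hermitian_NF, of 1 1] by (simp add: P_def[abs_def])
  have Pself: "Re (P z z) = b z + N0 z" for z by (simp add: P_def b_def NF_self)
  define r where "r = sqrt (Re (H x x) * Re (H y y))"
  have "(cmod (P x y))\<^sup>2 \<le> Re (P x x) * Re (P y y)"
    by (rule hermitian_form_Cauchy_Schwarz[OF P]) (simp add: Pself P0_nonneg)
  also have "\<dots> \<le> Re (H x x) * Re (H y y)"
    using P0_nonneg[of x] P0_nonneg[of y] N0_nonneg[of x] N0_nonneg[of y]
    by (intro mult_mono) (simp_all add: Pself H_self)
  finally have 1: "cmod (P x y) \<le> r" by (simp add: r_def real_le_rsqrt)
  have "(cmod (NF x y))\<^sup>2 \<le> Re (NF x x) * Re (NF y y)"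
    by (rule hermitian_form_Cauchy_Schwarz[OF hermitian_NF]) (simp add: NF_self N0_nonneg)
  also have "\<dots> \<le> Re (H x x) * Re (H y y)"
    using P0_nonneg[of x] P0_nonneg[of y] N0_nonneg[of x] N0_nonneg[of y]
    by (intro mult_mono) (simp_all add: NF_self H_self)
  finally have 2: "cmod (NF x y) \<le> r" by (simp add: r_def real_le_rsqrt)
  have "cmod (B x y) \<le> cmod (P x y) + cmod (NF x y)"
    using norm_triangle_ineq4[of "P x y" "NF x y"] by (simp add: P_def)
  then have "cmod (B x y) \<le> 2 * r" using 1 2 by linarith
  then have "(cmod (B x y))\<^sup>2 \<le> (2 * r)\<^sup>2" by (rule power_mono) simp
  also have "\<dots> = 4 * Re (H x x) * Re (H y y)"
    using H_nonneg[of x] H_nonneg[of y] by (simp add: r_def power_mult_distrib)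
  finally show ?thesis .
qed

text \<open>As b is invariant, only the pairings of T s x with the \<open>e i\<close> matter, and
  these are pairings of x with T (inv s) (e i). So it suffices that the orbits of the finitely many
  \<open>e i\<close> are bounded for H, where b is constant and N0 is controlled by
  \<open>B_bounded\<close>.\<close>

lemma H_translate_le:
  obtains C where "0 < C" "\<And>s x. s \<in> carrier G \<Longrightarrow> Re (H (T s x) (T s x)) \<le> C * Re (H x x)"
proof -
  have "\<exists>M. \<forall>s\<in>carrier G. N0 (T s (e i)) \<le> M" for i
  proof -
    obtain M where M: "\<And>j s. s \<in> carrier G \<Longrightarrow> cmod (B (T s (e i)) (e j)) \<le> M j"
      using choice[of "\<lambda>j M. \<forall>s\<in>carrier G. cmod (B (T s (e i)) (e j)) \<le> M"] B_bounded by blast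
    have "N0 (T s (e i)) \<le> (\<Sum>j<m. (M j)\<^sup>2)" if "s \<in> carrier G" for s
      unfolding N0_def by (intro sum_mono power_mono M that) simp
    then show ?thesis by blast
  qed
  then obtain M where M: "\<And>i s. s \<in> carrier G \<Longrightarrow> N0 (T s (e i)) \<le> M i"
    using choice[of "\<lambda>i M. \<forall>s\<in>carrier G. N0 (T s (e i)) \<le> M"] by blast
  have M0: "0 \<le> M i" for i using M[of \<one> i] N0_nonneg[of "T \<one> (e i)"] by simp
  \<comment> \<open>The summands bound 4 H on the orbits of the \<open>e i\<close>; the leading 1
    accounts for b and the factor 2 for H = b + 2 N0.\<close>
  define C where "C = 1 + 2 * (\<Sum>i<m. 4 * (\<bar>b (e i)\<bar> + 2 * M i))"
  have "Re (H (T s x) (T s x)) \<le> C * Re (H x x)" if s: "s \<in> carrier G" for s x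
  proof -
    have "(cmod (B (T s x) (e i)))\<^sup>2 \<le> 4 * (\<bar>b (e i)\<bar> + 2 * M i) * Re (H x x)" for i
    proof -
      have "(cmod (B (T s x) (e i)))\<^sup>2 \<le> 4 * Re (H x x) * Re (H (T (inv s) (e i)) (T (inv s) (e i)))"
        using B_le_H[of x "T (inv s) (e i)"] by (simp add: B_adjoint s)
      also have "\<dots> \<le> 4 * Re (H x x) * (\<bar>b (e i)\<bar> + 2 * M i)"
        using M[of "inv s" i] s H_nonneg[of x] by (intro mult_left_mono) (simp_all add: H_self b_invariant)
      finally show ?thesis by (simp only: mult_ac)
    qed
    then have "N0 (T s x) \<le> (\<Sum>i<m. 4 * (\<bar>b (e i)\<bar> + 2 * M i)) * Re (H x x)"
      unfolding N0_def sum_distrib_right by (rule sum_mono)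
    moreover have "b x \<le> Re (H x x)" using N0_nonneg[of x] by (simp add: H_self)
    ultimately show ?thesis
      using s by (simp add: H_self[of "T s x"] b_invariant C_def distrib_right)
  qed
  moreover have "0 < C" unfolding C_def
    by (rule add_pos_nonneg) (auto intro!: sum_nonneg M0 add_nonneg_nonneg)
  ultimately show ?thesis using that by blast
qed

end

text \<open>The double index (g, i) turns a sum of blocks into a single kernel, to which Schur's
  theorem applies.\<close>

lemma kernel_form_blocks:
  "kernel_form (\<lambda>g h. \<Sum>i<m. \<Sum>j<m. K (g, i) (h, j)) x x
    = kernel_sum (Poly_Mapping.keys x \<times> {..<m}) K (\<lambda>p. coeff_at x (fst p))" for m :: nat
proof -
  let ?A = "Poly_Mapping.keys x" and ?f = "\<lambda>g i h j. coeff_at x g * cnj (coeff_at x h) * K (g, i) (h, j)"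
  have "kernel_sum (?A \<times> {..<m}) K (\<lambda>p. coeff_at x (fst p)) = (\<Sum>g\<in>?A. \<Sum>i<m. \<Sum>h\<in>?A. \<Sum>j<m. ?f g i h j)"
  proof -
    have "sum F (?A \<times> {..<m}) = (\<Sum>g\<in>?A. \<Sum>i<m. F (g, i))" for F :: "_ \<Rightarrow> complex"
      by (simp add: sum.cartesian_product)
    then show ?thesis by (simp add: kernel_sum_def)
  qed
  also have "\<dots> = (\<Sum>g\<in>?A. \<Sum>h\<in>?A. \<Sum>i<m. \<Sum>j<m. ?f g i h j)"
    by (intro sum.cong refl sum.swap)
  finally show ?thesis by (simp add: kernel_form_sum sum_distrib_left)
qed

section \<open>Hilbert-Schmidt seminorms of finite-rank forms\<close>

context complex_vector_space
begin

text \<open>The Hilbert--Schmidt inner product, for the form \<open>S\<close>, of the operators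
  \<open>\<Sum>i<m. v g i \<otimes> v g i\<close>.\<close>

definition hs_kernel :: "('v \<Rightarrow> 'v \<Rightarrow> complex) \<Rightarrow> ('i \<Rightarrow> nat \<Rightarrow> 'v) \<Rightarrow> nat \<Rightarrow> 'i \<Rightarrow> 'i \<Rightarrow> complex" where
  "hs_kernel S v m g h = (\<Sum>i<m. \<Sum>j<m. of_real ((cmod (S (v g i) (v h j)))\<^sup>2))"

lemma hs_kernel_commute:
  assumes S: "hermitian_form S"
  shows "hs_kernel S v m h g = cnj (hs_kernel S v m g h)"
proof -
  have "cmod (S (v h i) (v g j)) = cmod (S (v g j) (v h i))" for i j
    using hermitian_form_commute[OF S, of "v h i" "v g j"] by simp
  then show ?thesis unfolding hs_kernel_def cnj_sum complex_cnj_complex_of_real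
    by (simp only:) (rule sum.swap)
qed

lemma hs_kernel_sum:
  "kernel_form (hs_kernel S v m) x x = kernel_sum (Poly_Mapping.keys x \<times> {..<m})
    (\<lambda>p q. of_real ((cmod (S (v (fst p) (snd p)) (v (fst q) (snd q))))\<^sup>2)) (\<lambda>p. coeff_at x (fst p))"
  unfolding kernel_form_blocks[symmetric] hs_kernel_def by simp

text \<open>\<open>kernel_sum_cmod_square_mono\<close> for the two Gram kernels. Comparison with the
  zero form gives nonnegativity, with a multiple of H the effect of translations, and with a
  rank-one form the continuity of evaluation.\<close>

lemma hs_kernel_mono:
  assumes S: "hermitian_form S" and nn: "\<And>x. 0 \<le> Re (S x x)"
    and S': "hermitian_form S'" and le: "\<And>x. Re (S x x) \<le> Re (S' x x)"
  shows "Re (kernel_form (hs_kernel S v m) x x) \<le> Re (kernel_form (hs_kernel S' v m) x x)"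
  unfolding hs_kernel_sum
proof (rule kernel_sum_cmod_square_mono)
  show "psd_on (Poly_Mapping.keys x \<times> {..<m}) (\<lambda>p q. S (v (fst p) (snd p)) (v (fst q) (snd q)))"
    by (rule psd_on_hermitian_form[OF S nn])
  have "hermitian_form (\<lambda>x y. S' x y - S x y)"
    by (rule hermitian_formI) (simp_all add: hermitian_form_simps[OF S] hermitian_form_simps[OF S']
        right_diff_distrib flip: hermitian_form_commute[OF S] hermitian_form_commute[OF S'])
  then show "psd_on (Poly_Mapping.keys x \<times> {..<m}) (\<lambda>p q. S' (v (fst p) (snd p)) (v (fst q) (snd q))
      - S (v (fst p) (snd p)) (v (fst q) (snd q)))"
    using psd_on_hermitian_form[of "\<lambda>x y. S' x y - S x y"] le by simp
qed simp

lemma hs_kernel_nonneg: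
  assumes S: "hermitian_form S" and nn: "\<And>x. 0 \<le> Re (S x x)"
  shows "0 \<le> Re (kernel_form (hs_kernel S v m) x x)"
proof -
  have "hermitian_form (\<lambda>x y. 0)" by (rule hermitian_formI) simp_all
  from hs_kernel_mono[OF this _ S, of v m x] nn show ?thesis
    by (simp add: hs_kernel_def kernel_form_sum)
qed

lemma hs_kernel_scale:
  "kernel_form (hs_kernel (\<lambda>x y. of_real c * S x y) v m) x x
    = of_real (c\<^sup>2) * kernel_form (hs_kernel S v m) x x"
proof -
  have "hs_kernel (\<lambda>x y. of_real c * S x y) v m g h = of_real (c\<^sup>2) * hs_kernel S v m g h" for g h
    by (simp add: hs_kernel_def norm_mult power_mult_distrib sum_distrib_left)
  then show ?thesis by (simp add: kernel_form_sum sum_distrib_left ac_simps)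
qed

end

section \<open>Convex combinations of translates of the negative part\<close>

context bounded_quasi_definite_representation
begin

text \<open>The value 0 outside the carrier makes \<open>v_shift\<close> hold for all g.\<close>

definition v where "v g i = (if g \<in> carrier G then T g (e i) else 0)"

lemma v_shift: "s \<in> carrier G \<Longrightarrow> v (shift s g) i = T s (v g i)"
  by (simp add: v_def shift_def T_mult T_zero)

text \<open>Squared Hilbert-Schmidt seminorm, taken with H, of the combination with coefficients l
  of the translates of the negative part.\<close>

definition q where "q l = Re (kernel_form (hs_kernel H v m) l l)"

lemma pos_q: "free.pos_form q"
  unfolding free.pos_form_def q_def[abs_def]
  using hs_kernel_nonneg[OF hermitian_H H_nonneg]
    free.quad_form_Re_hermitian_form[OF hermitian_kernel_form[of "hs_kernel H v m", OF hs_kernel_commute[OF hermitian_H]]]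
  by blast

lemma q_translate_le:
  obtains C where "0 < C" "\<And>s l. s \<in> carrier G \<Longrightarrow> q (translate s l) \<le> C * q l"
proof -
  obtain C where C: "0 < C" "\<And>s x. s \<in> carrier G \<Longrightarrow> Re (H (T s x) (T s x)) \<le> C * Re (H x x)"
    using H_translate_le by blast
  have CH: "hermitian_form (\<lambda>x y. of_real C * H x y)"
    using hermitian_form_combine[OF hermitian_H hermitian_H, of C 0] by simp
  have "q (translate s l) \<le> C\<^sup>2 * q l" if s: "s \<in> carrier G" for s l
  proof -
    have S: "hermitian_form (\<lambda>x y. H (T s x) (T s y))"
      by (rule hermitian_formI) (simp_all add: T_add T_scale s hermitian_form_simps[OF hermitian_H]
          flip: hermitian_form_commute[OF hermitian_H])
    have "q (translate s l) = Re (kernel_form (hs_kernel (\<lambda>x y. H (T s x) (T s y)) v m) l l)"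
      by (simp add: q_def kernel_form_translate s hs_kernel_def[abs_def] v_shift)
    also have "\<dots> \<le> Re (kernel_form (hs_kernel (\<lambda>x y. of_real C * H x y) v m) l l)"
      by (rule hs_kernel_mono[OF S _ CH]) (use C(2) s H_nonneg in auto)
    finally show ?thesis by (simp add: hs_kernel_scale q_def)
  qed
  then show ?thesis using that[of "C\<^sup>2"] C(1) by simp
qed

text \<open>The translate of \<open>N0\<close> by g, evaluated at x. Written with \<open>v\<close>
  it also makes sense outside the carrier, where it is 0.\<close>

definition w where "w x g = (\<Sum>i<m. (cmod (B (v g i) x))\<^sup>2)"

lemma w_carrier: "g \<in> carrier G \<Longrightarrow> w x g = N0 (T (inv g) x)"
proof -
  assume g: "g \<in> carrier G"
  have "cmod (B (v g i) x) = cmod (B (T (inv g) x) (e i))" for i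
    using hermitian_form_commute[OF B, of "e i" "T (inv g) x"] g by (simp add: v_def B_adjoint)
  then show ?thesis by (simp add: w_def N0_def)
qed

lemma w_translate: "s \<in> carrier G \<Longrightarrow> w (T s x) g = w x (shift (inv s) g)"
  by (simp add: w_def v_shift B_adjoint')

text \<open>Evaluation at x is bounded for \<open>q\<close>: the rank-one form \<open>S\<close> is
  at most 4 H x x times H by \<open>B_le_H\<close>, and its Hilbert-Schmidt kernel is the rank-one
  kernel of \<open>w x\<close>, whose quadratic form is the left side.\<close>

lemma lin_ext_w_le:
  "(cmod (lin_ext (\<lambda>g. of_real (w x g)) l))\<^sup>2 \<le> (4 * Re (H x x))\<^sup>2 * q l"
proof -
  define S where "S y z = B y x * B x z" for y z
  have S: "hermitian_form S"
    by (rule hermitian_formI) (simp_all add: S_def hermitian_form_simps[OF B] distrib_right mult.assoc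
        mult.commute[of "B _ x" "B x _"] flip: hermitian_form_commute[OF B])
  have S_self: "Re (S y y) = (cmod (B y x))\<^sup>2" for y
    by (simp add: S_def hermitian_form_commute[OF B, of x y] cmod_power2 flip: power2_eq_square)
  have CH: "hermitian_form (\<lambda>y z. of_real (4 * Re (H x x)) * H y z)"
    using hermitian_form_combine[OF hermitian_H hermitian_H, of "4 * Re (H x x)" 0] by simp
  have "hs_kernel S v m g h = of_real (w x g) * cnj (of_real (w x h))" for g h
  proof -
    have "cmod (S (v g i) (v h j)) = cmod (B (v g i) x) * cmod (B (v h j) x)" for i j
      by (simp add: S_def norm_mult hermitian_form_commute[OF B, of x "v h j"])
    then show ?thesis
      unfolding hs_kernel_def w_def complex_cnj_complex_of_real of_real_sum sum_product
      by (simp add: power_mult_distrib sum_product)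
  qed
  then have "(cmod (lin_ext (\<lambda>g. of_real (w x g)) l))\<^sup>2 = Re (kernel_form (hs_kernel S v m) l l)"
    using kernel_form_rank_one[of "\<lambda>g. of_real (w x g)" l] by (simp add: kernel_form_def)
  also have "\<dots> \<le> Re (kernel_form (hs_kernel (\<lambda>y z. of_real (4 * Re (H x x)) * H y z) v m) l l)"
    by (rule hs_kernel_mono[OF S _ CH]) (use B_le_H[of _ x] in \<open>simp_all add: S_self ac_simps\<close>)
  finally show ?thesis unfolding hs_kernel_scale q_def by simp
qed

text \<open>Finitely supported probability measures on the group, with weights embedded in the
  complex free space.\<close>

definition \<Delta> where
  "\<Delta> = {l. Poly_Mapping.keys l \<subseteq> carrier G \<and> (\<forall>g. coeff_at l g \<in> \<real> \<and> 0 \<le> Re (coeff_at l g)) \<and> lin_ext (\<lambda>_. 1) l = 1}"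

definition average where "average l x = Re (lin_ext (\<lambda>g. of_real (w x g)) l)"

lemma average_eq:
  assumes "l \<in> \<Delta>"
  shows "average l x = (\<Sum>g\<in>Poly_Mapping.keys l. Re (coeff_at l g) * N0 (T (inv g) x))"
  unfolding average_def lin_ext_def Re_sum
  using assms by (intro sum.cong) (auto simp: \<Delta>_def w_carrier)

lemma quad_average:
  assumes l: "l \<in> \<Delta>" shows "quad_form (average l)"
proof (rule quad_formI)
  have g: "g \<in> carrier G" if "g \<in> Poly_Mapping.keys l" for g using l that by (auto simp: \<Delta>_def)
  show "average l (c *s x) = (cmod c)\<^sup>2 * average l x" for c x
    unfolding average_eq[OF l] sum_distrib_left
    by (rule sum.cong) (simp_all add: T_scale g quad_form_scale[OF quad_N0])
  have "Re (coeff_at l g) * N0 (T (inv g) (x + y)) + Re (coeff_at l g) * N0 (T (inv g) (x - y))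
      = 2 * (Re (coeff_at l g) * N0 (T (inv g) x)) + 2 * (Re (coeff_at l g) * N0 (T (inv g) y))"
    if "g \<in> Poly_Mapping.keys l" for g x y
    using quad_form_parallelogram[OF quad_N0, of "T (inv g) x" "T (inv g) y"] g[OF that]
    unfolding mult.left_commute[of 2] distrib_left[symmetric] by (simp add: T_add T_diff)
  then show "average l (x + y) + average l (x - y) = 2 * average l x + 2 * average l y" for x y
    unfolding average_eq[OF l] sum_distrib_left sum.distrib[symmetric] by (intro sum.cong refl)
qed

lemma average_nonneg: "l \<in> \<Delta> \<Longrightarrow> 0 \<le> average l x"
  unfolding average_eq by (intro sum_nonneg mult_nonneg_nonneg N0_nonneg) (simp add: \<Delta>_def)

text \<open>Since b is invariant and the weights sum to 1, this is an average of
  \<open>P0_nonneg\<close> over translates.\<close>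

lemma average_b_nonneg:
  assumes l: "l \<in> \<Delta>" shows "0 \<le> average l x + b x"
proof -
  have "(\<Sum>g\<in>Poly_Mapping.keys l. Re (coeff_at l g)) = 1"
  proof -
    have "Re (lin_ext (\<lambda>_. 1) l) = 1" using l by (simp add: \<Delta>_def)
    then show ?thesis by (simp add: lin_ext_def)
  qed
  then have "b x = (\<Sum>g\<in>Poly_Mapping.keys l. Re (coeff_at l g) * b x)"
    by (simp flip: sum_distrib_right)
  also have "\<dots> = (\<Sum>g\<in>Poly_Mapping.keys l. Re (coeff_at l g) * b (T (inv g) x))"
    using l by (intro sum.cong) (auto simp: \<Delta>_def b_invariant)
  finally have "average l x + b x
      = (\<Sum>g\<in>Poly_Mapping.keys l. Re (coeff_at l g) * (b (T (inv g) x) + N0 (T (inv g) x)))"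
    by (simp add: average_eq[OF l] sum.distrib distrib_left)
  also have "0 \<le> \<dots>"
    using l by (intro sum_nonneg mult_nonneg_nonneg P0_nonneg) (simp add: \<Delta>_def)
  finally show ?thesis .
qed

lemma average_diff: "(average k x - average l x)\<^sup>2 \<le> (4 * Re (H x x))\<^sup>2 * q (k - l)"
proof -
  have "\<bar>average k x - average l x\<bar> \<le> cmod (lin_ext (\<lambda>g. of_real (w x g)) (k - l))"
    unfolding average_def minus_complex.simps[symmetric] lin_ext_diff[symmetric] by (rule abs_Re_le_cmod)
  then have "(average k x - average l x)\<^sup>2 \<le> (cmod (lin_ext (\<lambda>g. of_real (w x g)) (k - l)))\<^sup>2"
    by (metis abs_ge_zero power2_abs power_mono)
  also note lin_ext_w_le
  finally show ?thesis .
qed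

lemma average_translate: "s \<in> carrier G \<Longrightarrow> average l (T s x) = average (translate (inv s) l) x"
  by (simp add: average_def lin_ext_translate w_translate)

lemma translate_\<Delta>: "s \<in> carrier G \<Longrightarrow> l \<in> \<Delta> \<Longrightarrow> translate s l \<in> \<Delta>"
  by (auto simp: \<Delta>_def keys_translate lookup_translate lin_ext_translate) (auto simp: shift_def)

lemma convex_\<Delta>: "k \<in> \<Delta> \<Longrightarrow> l \<in> \<Delta> \<Longrightarrow> smul (1/2) (k + l) \<in> \<Delta>"
proof -
  assume k: "k \<in> \<Delta>" and l: "l \<in> \<Delta>"
  have "Poly_Mapping.keys (smul (1/2) (k + l)) \<subseteq> Poly_Mapping.keys k \<union> Poly_Mapping.keys l"
    by (auto simp: in_keys_iff lookup_add)
  then show ?thesis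
    using k l by (auto simp: \<Delta>_def lookup_add lin_ext_add lin_ext_smul)
qed

lemma \<Delta>_nonempty: "Poly_Mapping.single \<one> 1 \<in> \<Delta>"
  by (auto simp: \<Delta>_def lookup_single when_def)

text \<open>The approximately fixed sequence need not converge in \<Delta>. Evaluation at each x is
  bounded for \<open>q\<close>, so the averaged forms converge pointwise, and asymptotic invariance
  becomes invariance of the limit.\<close>

theorem invariant_majorant:
  obtains N where "pos_form N" "pos_form (\<lambda>x. N x + b x)" "\<And>s x. s \<in> carrier G \<Longrightarrow> N (T s x) = N x"
proof -
  obtain C where C: "0 < C" "\<And>s l. s \<in> carrier G \<Longrightarrow> q (translate s l) \<le> C * q l"
    using q_translate_le by blast
  have ge: "q l \<le> C * q (translate s l)" if "s \<in> carrier G" for s l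
    using C(2)[of "inv s" "translate s l"] that by (simp add: translate_mult[symmetric] translate_one)
  have id: "id \<in> translate ` carrier G"
    using translate_one by (intro image_eqI[of _ _ \<one>]) (auto simp: fun_eq_iff)
  have comp: "S \<circ> S' \<in> translate ` carrier G"
    if S: "S \<in> translate ` carrier G" "S' \<in> translate ` carrier G" for S S'
  proof -
    obtain s s' where s: "S = translate s" "S' = translate s'" "s \<in> carrier G" "s' \<in> carrier G"
      using S by blast
    then have "S \<circ> S' = translate (s \<otimes> s')" by (simp add: fun_eq_iff translate_mult)
    then show ?thesis using s by simp
  qed
  obtain l :: "nat \<Rightarrow> 'a \<Rightarrow>\<^sub>0 complex" where l: "\<And>n. l n \<in> \<Delta>"
    and l_lim: "\<And>S d. S \<in> translate ` carrier G \<Longrightarrow> 0 < d \<Longrightarrow> \<exists>k. \<forall>n\<ge>k. \<forall>m\<ge>k. q (S (l n) - l m) < d"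
    by (rule free.approximate_fixed_points[OF pos_q C(1) id comp _ _ _ _ convex_\<Delta> _ \<Delta>_nonempty])
      (auto simp: translate_add translate_smul C(2) ge translate_\<Delta>)
  have close: "\<exists>k. \<forall>n\<ge>k. \<forall>m\<ge>k. \<bar>average (translate s (l n)) x - average (l m) x\<bar> < d"
    if s: "s \<in> carrier G" and d: "0 < d" for s x d
  proof -
    \<comment> \<open>The summand 1 keeps c positive where H vanishes.\<close>
    define c where "c = (4 * Re (H x x))\<^sup>2 + 1"
    have c: "0 < c" by (simp add: c_def add_nonneg_pos)
    obtain k where k: "\<And>n m. k \<le> n \<Longrightarrow> k \<le> m \<Longrightarrow> q (translate s (l n) - l m) < d\<^sup>2 / c"
      using l_lim[of "translate s" "d\<^sup>2 / c"] s d c by auto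
    have "\<bar>average (translate s (l n)) x - average (l m) x\<bar> < d" if "k \<le> n" "k \<le> m" for n m
    proof -
      have "(average (translate s (l n)) x - average (l m) x)\<^sup>2 \<le> c * q (translate s (l n) - l m)"
        using average_diff[of "translate s (l n)" x "l m"] pos_q by (simp add: c_def distrib_right free.pos_form_def add_increasing2)
      also have "\<dots> < d\<^sup>2" using k[OF that] c by (simp add: field_simps)
      finally show ?thesis using d by (metis abs_of_pos power2_abs power2_less_imp_less less_imp_le)
    qed
    then show ?thesis by blast
  qed
  have "Cauchy (\<lambda>n. average (l n) x)" for x
    unfolding Cauchy_def dist_real_def using close[of \<one> _ x] by (simp add: translate_one)
  then have "\<exists>L. (\<lambda>n. average (l n) x) \<longlonglongrightarrow> L" for x
    by (simp add: Cauchy_convergent_iff convergent_def)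
  then obtain N where N: "\<And>x. (\<lambda>n. average (l n) x) \<longlonglongrightarrow> N x" by metis
  have quad: "quad_form N" by (rule quad_form_tendsto[OF quad_average[OF l] N])
  have "pos_form N"
    unfolding pos_form_def using quad LIMSEQ_le_const[OF N] average_nonneg[OF l] by blast
  moreover have "pos_form (\<lambda>x. N x + b x)"
    unfolding pos_form_def
    using quad_form_add[OF quad quad_b] LIMSEQ_le_const[OF tendsto_add[OF N tendsto_const]] average_b_nonneg[OF l] by blast
  moreover have "N (T s x) = N x" if s: "s \<in> carrier G" for s x
  proof -
    have "(\<lambda>n. average (l n) (T s x) - average (l n) x) \<longlonglongrightarrow> 0"
    proof (rule LIMSEQ_I)
      fix r :: real assume "0 < r"
      then show "\<exists>k. \<forall>n\<ge>k. norm (average (l n) (T s x) - average (l n) x - 0) < r"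
        using close[of "inv s" r x] s by (auto simp: average_translate)
    qed
    then show ?thesis
      using LIMSEQ_unique[OF tendsto_diff[OF N N, of "T s x" x]] by fastforce
  qed
  ultimately show ?thesis using that by blast
qed

end

section \<open>Counting negative eigenvalues\<close>

text \<open>Gaussian elimination: a nonzero entry of row \<open>i0\<close> solves that equation for
  one unknown, which is then eliminated from the others.\<close>

lemma underdetermined_system:
  fixes M :: "'i \<Rightarrow> 'j \<Rightarrow> 'c::field"
  assumes "finite F" "finite J" "card F < card J"
  shows "\<exists>c. (\<exists>j\<in>J. c j \<noteq> 0) \<and> (\<forall>i\<in>F. (\<Sum>j\<in>J. c j * M i j) = 0)"
  using assms
proof (induction F arbitrary: J M rule: finite_induct)
  case empty
  then have "J \<noteq> {}" by auto
  then show ?case by (intro exI[of _ "\<lambda>_. 1"]) auto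
next
  case (insert i0 F)
  show ?case
  proof (cases "\<forall>j\<in>J. M i0 j = 0")
    case True
    have "card F < card J" using insert by simp
    from insert.IH[OF insert.prems(1) this, of M] show ?thesis using True by auto
  next
    case False
    then obtain j0 where j0: "j0 \<in> J" "M i0 j0 \<noteq> 0" by blast
    define M' where "M' i j = M i j - M i j0 * M i0 j / M i0 j0" for i j
    have "card F < card (J - {j0})" using insert j0 by simp
    from insert.IH[OF _ this, of M'] insert.prems(1) obtain c where
      c: "\<exists>j\<in>J - {j0}. c j \<noteq> 0" "\<And>i. i \<in> F \<Longrightarrow> (\<Sum>j\<in>J - {j0}. c j * M' i j) = 0"
      by auto
    define s where "s = (\<Sum>j\<in>J - {j0}. c j * M i0 j)"
    define d where "d = c(j0 := - s / M i0 j0)"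
    have sum: "(\<Sum>j\<in>J. d j * M i j) = - s / M i0 j0 * M i j0 + (\<Sum>j\<in>J - {j0}. c j * M i j)" for i
    proof -
      have "(\<Sum>j\<in>J - {j0}. d j * M i j) = (\<Sum>j\<in>J - {j0}. c j * M i j)"
        by (rule sum.cong) (auto simp: d_def)
      then show ?thesis
        using sum.remove[OF insert.prems(1) j0(1), of "\<lambda>j. d j * M i j"] by (simp add: d_def)
    qed
    have "(\<Sum>j\<in>J. d j * M i j) = 0" if "i \<in> insert i0 F" for i
    proof (cases "i = i0")
      case True
      then show ?thesis using j0 by (simp add: sum s_def)
    next
      case False
      then have "(\<Sum>j\<in>J - {j0}. c j * M i j - M i j0 / M i0 j0 * (c j * M i0 j)) = 0"
        using c(2)[of i] that by (simp add: M'_def algebra_simps)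
      then show ?thesis
        unfolding sum sum_subtractf sum_distrib_left[symmetric] s_def[symmetric] by simp
    qed
    moreover have "\<exists>j\<in>J. d j \<noteq> 0" using c(1) by (auto simp: d_def)
    ultimately show ?thesis by blast
  qed
qed

text \<open>All that the diagonalization uses about the shape of a Jordan matrix: nonzero
  off-diagonal entries lie on the superdiagonal, inside one block.\<close>

lemma jordan_matrix_off_diagonal:
  assumes "i < sum_list (map fst bs)" "j < sum_list (map fst bs)" "i \<noteq> j"
    and "jordan_matrix bs $$ (i, j) \<noteq> (0::'c::{zero,one})"
  shows "j = Suc i \<and> jordan_matrix bs $$ (i, i) = jordan_matrix bs $$ (j, j)"
  using assms
proof (induction bs arbitrary: i j)
  case (Cons na bs)
  obtain n a where na: "na = (n, a)" by force
  let ?N = "sum_list (map fst bs)"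
  have idx: "jordan_matrix (na # bs) $$ (i, j) =
      (if i < n then if j < n then jordan_block n a $$ (i, j) else 0
       else if j < n then 0 else jordan_matrix bs $$ (i - n, j - n))"
    if "i < n + ?N" "j < n + ?N" for i j
    using that unfolding na jordan_matrix_Cons by (subst index_mat_four_block) auto
  from Cons.prems have ij: "i < n + ?N" "j < n + ?N" by (auto simp: na)
  show ?case
  proof (cases "i < n \<or> j < n")
    case True
    then show ?thesis
      using Cons.prems(3,4) ij unfolding idx[OF ij] idx[OF ij(1,1)] idx[OF ij(2,2)]
      by (auto split: if_splits)
  next
    case False
    then have "j - n = Suc (i - n) \<and> jordan_matrix bs $$ (i - n, i - n) = jordan_matrix bs $$ (j - n, j - n)"
      using Cons.prems(3,4) ij unfolding idx[OF ij] by (intro Cons.IH) auto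
    then show ?thesis using False unfolding idx[OF ij(1,1)] idx[OF ij(2,2)] by auto
  qed
qed simp

lemma order_prod_linear_factors:
  "Polynomial.order e (\<Prod>a\<leftarrow>as. [:- a, 1:]) = count_list as (e::complex)"
proof (induction as)
  case (Cons a as)
  have nz: "(\<Prod>a\<leftarrow>as. [:- a, 1:]) \<noteq> (0::complex poly)" by (auto simp: prod_list_zero_iff)
  then have "[:- a, 1:] * (\<Prod>a\<leftarrow>as. [:- a, 1:]) \<noteq> 0" unfolding mult_eq_0_iff by simp
  from order_mult[OF this, of e] Cons show ?case by (simp add: order_linear' del: mult_pCons_left)
qed (simp add: order_1_eq_0)

text \<open>Obtained by showing that the Jordan form has no superdiagonal entries. The columns of P
  are eigenvectors but not normalized; orthogonality is claimed only for distinct eigenvalues, which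
  suffices for counting signs.\<close>

lemma hermitian_diagonalization:
  fixes A :: "complex mat"
  assumes A: "A \<in> carrier_mat n n" and herm: "\<And>i j. i < n \<Longrightarrow> j < n \<Longrightarrow> A $$ (j, i) = cnj (A $$ (i, j))"
  obtains P Q d where "P \<in> carrier_mat n n" "Q \<in> carrier_mat n n" "P * Q = 1\<^sub>m n"
    "char_poly A = (\<Prod>a\<leftarrow>map d [0..<n]. [:- complex_of_real a, 1:])"
    "\<And>i j. i < n \<Longrightarrow> j < n \<Longrightarrow> (\<Sum>a<n. \<Sum>b<n. cnj (P $$ (a, i)) * A $$ (a, b) * P $$ (b, j))
        = of_real (d j) * (\<Sum>a<n. cnj (P $$ (a, i)) * P $$ (a, j))"
    "\<And>i j. i < n \<Longrightarrow> j < n \<Longrightarrow> d i \<noteq> d j \<Longrightarrow> (\<Sum>a<n. cnj (P $$ (a, i)) * P $$ (a, j)) = 0"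
proof -
  obtain as where as: "char_poly A = (\<Prod>a\<leftarrow>as. [:- a, 1:])"
    using char_poly_factorized[OF A] by blast
  obtain bs where bs: "jordan_nf A bs" using jordan_nf_exists[OF A as] by blast
  define J where "J = jordan_matrix bs"
  have sim: "similar_mat A J" using bs by (simp add: jordan_nf_def J_def)
  then obtain P Q where wit: "similar_mat_wit A J P Q" by (auto simp: similar_mat_def)
  have c: "J \<in> carrier_mat n n" "P \<in> carrier_mat n n" "Q \<in> carrier_mat n n"
    and PQ: "P * Q = 1\<^sub>m n" and QP: "Q * P = 1\<^sub>m n" and APJQ: "A = P * J * Q"
    using wit A by (auto simp: similar_mat_wit_def Let_def)
  have N: "sum_list (map fst bs) = n" using c(1) by (auto simp: J_def)
  have "A * P = P * J * (Q * P)"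
    unfolding APJQ using c by (simp add: assoc_mult_mat[of _ n n _ n _ n])
  then have AP: "A * P = P * J" using c by (simp add: QP)
  have AP': "(\<Sum>b<n. A $$ (a, b) * P $$ (b, j)) = (\<Sum>k<n. P $$ (a, k) * J $$ (k, j))"
    if "a < n" "j < n" for a j
    using arg_cong[OF AP, of "\<lambda>M. M $$ (a, j)"] that A c
    by (simp add: scalar_prod_def atLeast0LessThan)
  define ip where "ip i j = (\<Sum>a<n. cnj (P $$ (a, i)) * P $$ (a, j))" for i j
  define bil where "bil i j = (\<Sum>a<n. \<Sum>b<n. cnj (P $$ (a, i)) * A $$ (a, b) * P $$ (b, j))" for i j
  have ip_cnj: "ip j i = cnj (ip i j)" for i j by (simp add: ip_def mult.commute)
  have bil_cnj: "bil j i = cnj (bil i j)" for i j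
  proof -
    have "cnj (bil i j) = (\<Sum>a<n. \<Sum>b<n. cnj (P $$ (b, j)) * A $$ (b, a) * P $$ (a, i))"
      unfolding bil_def cnj_sum by (intro sum.cong refl) (simp add: herm[symmetric] ac_simps)
    then show ?thesis unfolding bil_def by (subst sum.swap) simp
  qed
  have bil: "bil i j = (\<Sum>k<n. ip i k * J $$ (k, j))" if "j < n" for i j
  proof -
    have "bil i j = (\<Sum>a<n. cnj (P $$ (a, i)) * (\<Sum>b<n. A $$ (a, b) * P $$ (b, j)))"
      by (simp add: bil_def sum_distrib_left mult.assoc)
    also have "\<dots> = (\<Sum>a<n. \<Sum>k<n. cnj (P $$ (a, i)) * (P $$ (a, k) * J $$ (k, j)))"
      using that by (simp add: AP' sum_distrib_left)
    also have "\<dots> = (\<Sum>k<n. ip i k * J $$ (k, j))"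
      by (subst sum.swap) (simp add: ip_def sum_distrib_right mult.assoc)
    finally show ?thesis .
  qed
  have ip_pos: "ip i i \<noteq> 0" if "i < n" for i
  proof
    assume "ip i i = 0"
    then have "(\<Sum>a<n. (cmod (P $$ (a, i)))\<^sup>2) = 0"
      unfolding ip_def by (simp add: mult.commute of_real_eq_0_iff flip: complex_norm_square of_real_power of_real_sum)
    then have "P $$ (a, i) = 0" if "a < n" for a using that by (simp add: sum_nonneg_eq_0_iff)
    then have "(Q * P) $$ (i, i) = 0" using c that by (simp add: scalar_prod_def)
    then show False using that by (simp add: QP)
  qed
  have off: "j = Suc i \<and> J $$ (i, i) = J $$ (j, j)"
    if "i < n" "j < n" "i \<noteq> j" "J $$ (i, j) \<noteq> 0" for i j
    using jordan_matrix_off_diagonal[of i bs j] that by (simp add: N J_def)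
  have single: "(\<Sum>k<n. ip i k * J $$ (k, j)) = ip i j * J $$ (j, j)"
    if "j < n" "\<And>k. k < n \<Longrightarrow> k \<noteq> j \<Longrightarrow> J $$ (k, j) = 0" for i j
    using that by (subst sum.remove[of _ j]) auto
  have diag: "\<forall>k<n. k \<noteq> j \<longrightarrow> J $$ (k, j) = 0" if "j < n" for j
    using that
  proof (induction j)
    case 0
    then show ?case using off[of _ 0] by blast
  next
    case (Suc i)
    show ?case
    proof (rule ccontr)
      assume "\<not> ?thesis"
      then obtain k where "k < n" "k \<noteq> Suc i" "J $$ (k, Suc i) \<noteq> 0" by blast
      then have nz: "J $$ (i, Suc i) \<noteq> 0" and eq: "J $$ (Suc i, Suc i) = J $$ (i, i)"
        using off[of k "Suc i"] Suc.prems by auto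
      have i: "i < n" using Suc.prems by simp
      have coli: "bil x i = ip x i * J $$ (i, i)" for x
        using bil[OF i] single[OF i] Suc.IH i by simp
      have "cnj (ip i i * J $$ (i, i)) = ip i i * J $$ (i, i)"
        using bil_cnj[of i i] coli[of i] by metis
      then have real: "cnj (J $$ (i, i)) = J $$ (i, i)"
        using ip_cnj[of i i] ip_pos[OF i] by simp
      have "J $$ (k, Suc i) = 0" if "k < n" "k \<noteq> Suc i" "k \<noteq> i" for k
        using off[of k "Suc i"] that Suc.prems by auto
      \<comment> \<open>Column i is an eigenvector with a real eigenvalue. Computing
        \<open>bil i (Suc i)\<close> from column i + 1 and, by Hermitian symmetry, from column i
        gives values that differ by \<open>ip i i\<close> times the superdiagonal entry.\<close>
      then have "bil i (Suc i) = ip i (Suc i) * J $$ (i, i) + ip i i * J $$ (i, Suc i)"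
        unfolding bil[OF Suc.prems] using Suc.prems
        by (subst sum.remove[of _ "Suc i"], simp, simp, subst sum.remove[of _ i]) (auto simp: eq)
      moreover have "bil i (Suc i) = ip i (Suc i) * J $$ (i, i)"
        using bil_cnj[of i "Suc i"] coli[of "Suc i"] ip_cnj[of i "Suc i"] real by simp
      ultimately show False using nz ip_pos[OF i] by simp
    qed
  qed
  have bil': "bil i j = ip i j * J $$ (j, j)" if "j < n" for i j
    using bil[OF that] single[OF that] diag[OF that] by simp
  define d where "d i = Re (J $$ (i, i))" for i
  have d: "J $$ (i, i) = of_real (d i)" if "i < n" for i
  proof -
    have "cnj (ip i i * J $$ (i, i)) = ip i i * J $$ (i, i)"
      using bil_cnj[of i i] bil'[OF that, of i] by metis
    then have "cnj (J $$ (i, i)) = J $$ (i, i)"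
      using ip_cnj[of i i] ip_pos[OF that] by simp
    then show ?thesis by (simp add: d_def complex_eq_iff)
  qed
  show ?thesis
  proof (rule that[of P Q d])
    have "upper_triangular J"
      using jordan_matrix_upper_triangular[of _ bs] c(1) by (auto simp: J_def N)
    then have "char_poly A = (\<Prod>a\<leftarrow>diag_mat J. [:- a, 1:])"
      using char_poly_similar[OF sim] char_poly_upper_triangular[OF c(1)] by simp
    also have "diag_mat J = map (\<lambda>i. of_real (d i)) [0..<n]"
      using c(1) d by (auto simp: diag_mat_def)
    finally show "char_poly A = (\<Prod>a\<leftarrow>map d [0..<n]. [:- complex_of_real a, 1:])"
      by (simp add: comp_def)
  next
    fix i j assume ij: "i < n" "j < n"
    show "(\<Sum>a<n. \<Sum>b<n. cnj (P $$ (a, i)) * A $$ (a, b) * P $$ (b, j))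
        = of_real (d j) * (\<Sum>a<n. cnj (P $$ (a, i)) * P $$ (a, j))"
      using bil'[OF ij(2), of i] by (simp add: bil_def ip_def d[OF ij(2)] mult.commute)
    assume "d i \<noteq> d j"
    moreover have "bil i j = of_real (d i) * ip i j"
      unfolding bil_cnj[of i j] bil'[OF ij(1), of j] ip_cnj[of i j] by (simp add: d[OF ij(1)])
    ultimately show "(\<Sum>a<n. cnj (P $$ (a, i)) * P $$ (a, j)) = 0"
      using bil'[OF ij(2), of i] by (simp add: d[OF ij(2)] flip: ip_def)
  qed (fact c PQ)+
qed

text \<open>Multiplicities are the sizes of the fibres of d over its negative values, and these add
  up to the number of indices.\<close>

lemma num_neg_eigenvalues_linear_factors:
  assumes A: "A \<in> carrier_mat n n"
    and cp: "char_poly A = (\<Prod>a\<leftarrow>map d [0..<n]. [:- complex_of_real a, 1:])"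
  shows "num_neg_eigenvalues A = card {i. i < n \<and> d i < 0}"
proof -
  let ?I = "{i. i < n \<and> d i < 0}"
  define as where "as = map (\<lambda>i. complex_of_real (d i)) [0..<n]"
  have cp': "char_poly A = (\<Prod>a\<leftarrow>as. [:- a, 1:])" by (simp add: cp as_def comp_def)
  have "eigenvalue A z \<longleftrightarrow> z \<in> set as" for z
    unfolding eigenvalue_root_char_poly[OF A] cp' by (auto simp: poly_prod_list prod_list_zero_iff)
  then have neg: "neg_eigenvalues A = (\<lambda>i. complex_of_real (d i)) ` ?I"
    by (auto simp: neg_eigenvalues_def as_def)
  have "num_neg_eigenvalues A = (\<Sum>z\<in>neg_eigenvalues A. card {i \<in> ?I. complex_of_real (d i) = z})"
    unfolding num_neg_eigenvalues_def
  proof (rule sum.cong)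
    fix z assume "z \<in> neg_eigenvalues A"
    then have "Re z < 0" by (simp add: neg_eigenvalues_def)
    have "Polynomial.order z (char_poly A) = card {i. i < n \<and> complex_of_real (d i) = z}"
      unfolding cp' order_prod_linear_factors as_def count_list_eq_length_filter length_filter_conv_card
      by (rule arg_cong[of _ _ card]) auto
    also have "{i. i < n \<and> complex_of_real (d i) = z} = {i \<in> ?I. complex_of_real (d i) = z}"
    proof -
      have "d i < 0" if "complex_of_real (d i) = z" for i
        using that \<open>Re z < 0\<close> by (metis Re_complex_of_real)
      then show ?thesis by blast
    qed
    finally show "Polynomial.order z (char_poly A) = card {i \<in> ?I. complex_of_real (d i) = z}" .
  qed simp
  also have "\<dots> = card ?I"
    unfolding neg by (subst card_eq_sum[of ?I], subst sum.image_gen[of ?I _ "\<lambda>i. complex_of_real (d i)"]) auto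
  finally show ?thesis .
qed

lemma sum_swap_pairs:
  "(\<Sum>a\<in>A. \<Sum>b\<in>B. \<Sum>i\<in>I. \<Sum>j\<in>J. F a b i j) = (\<Sum>i\<in>I. \<Sum>j\<in>J. \<Sum>a\<in>A. \<Sum>b\<in>B. F a b i j)"
proof -
  have "(\<Sum>a\<in>A. \<Sum>b\<in>B. \<Sum>i\<in>I. \<Sum>j\<in>J. F a b i j) = (\<Sum>a\<in>A. \<Sum>i\<in>I. \<Sum>b\<in>B. \<Sum>j\<in>J. F a b i j)"
    by (intro sum.cong refl sum.swap)
  also have "\<dots> = (\<Sum>i\<in>I. \<Sum>a\<in>A. \<Sum>b\<in>B. \<Sum>j\<in>J. F a b i j)"
    by (rule sum.swap)
  also have "\<dots> = (\<Sum>i\<in>I. \<Sum>a\<in>A. \<Sum>j\<in>J. \<Sum>b\<in>B. F a b i j)"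
    by (intro sum.cong refl sum.swap)
  also have "\<dots> = (\<Sum>i\<in>I. \<Sum>j\<in>J. \<Sum>a\<in>A. \<Sum>b\<in>B. F a b i j)"
    by (intro sum.cong refl sum.swap)
  finally show ?thesis .
qed

text \<open>One half of Sylvester's law of inertia: there are fewer negative eigenvalues than
  coefficients, so some nontrivial combination has zero coordinates at all of them, and there the
  form is nonnegative.\<close>

lemma nonnegative_combination:
  fixes A :: "complex mat" and Y :: "nat \<Rightarrow> nat \<Rightarrow> complex"
  assumes A: "A \<in> carrier_mat n n" and herm: "\<And>i j. i < n \<Longrightarrow> j < n \<Longrightarrow> A $$ (j, i) = cnj (A $$ (i, j))"
    and less: "num_neg_eigenvalues A < m"
  obtains c where "\<exists>j<m. c j \<noteq> 0"
    "0 \<le> Re (\<Sum>a<n. \<Sum>b<n. cnj (\<Sum>j<m. c j * Y j a) * A $$ (a, b) * (\<Sum>j<m. c j * Y j b))"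
proof -
  obtain P Q d where P: "P \<in> carrier_mat n n" and Q: "Q \<in> carrier_mat n n" and PQ: "P * Q = 1\<^sub>m n"
    and cp: "char_poly A = (\<Prod>a\<leftarrow>map d [0..<n]. [:- complex_of_real a, 1:])"
    and bil: "\<And>i j. i < n \<Longrightarrow> j < n \<Longrightarrow> (\<Sum>a<n. \<Sum>b<n. cnj (P $$ (a, i)) * A $$ (a, b) * P $$ (b, j))
        = of_real (d j) * (\<Sum>a<n. cnj (P $$ (a, i)) * P $$ (a, j))"
    and orth: "\<And>i j. i < n \<Longrightarrow> j < n \<Longrightarrow> d i \<noteq> d j \<Longrightarrow> (\<Sum>a<n. cnj (P $$ (a, i)) * P $$ (a, j)) = 0"
    using hermitian_diagonalization[OF A herm] by blast
  let ?I = "{i. i < n \<and> d i < 0}"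
  have "card ?I < card {..<m}"
    using less num_neg_eigenvalues_linear_factors[OF A cp] by simp
  then obtain c where c: "\<exists>j\<in>{..<m}. c j \<noteq> 0"
    "\<And>i. i \<in> ?I \<Longrightarrow> (\<Sum>j<m. c j * (\<Sum>a<n. Q $$ (i, a) * Y j a)) = 0"
    using underdetermined_system[of ?I "{..<m}" "\<lambda>i j. \<Sum>a<n. Q $$ (i, a) * Y j a"] by auto
  define z where "z a = (\<Sum>j<m. c j * Y j a)" for a
  define t where "t i = (\<Sum>a<n. Q $$ (i, a) * z a)" for i
  have t0: "t i = 0" if "i < n" "d i < 0" for i
  proof -
    have "t i = (\<Sum>j<m. c j * (\<Sum>a<n. Q $$ (i, a) * Y j a))"
      unfolding t_def z_def sum_distrib_left by (subst sum.swap) (simp add: ac_simps)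
    then show ?thesis using c(2)[of i] that by simp
  qed
  have z: "z a = (\<Sum>i<n. t i * P $$ (a, i))" if "a < n" for a
  proof -
    have "(\<Sum>i<n. P $$ (a, i) * Q $$ (i, b)) = of_bool (a = b)" if "b < n" for b
      using arg_cong[OF PQ, of "\<lambda>M. M $$ (a, b)"] \<open>a < n\<close> that P Q
      by (simp add: scalar_prod_def atLeast0LessThan of_bool_def)
    then have "(\<Sum>b<n. (\<Sum>i<n. P $$ (a, i) * Q $$ (i, b)) * z b) = (\<Sum>b<n. of_bool (a = b) * z b)"
      by (intro sum.cong) auto
    also have "\<dots> = z a" using that by (simp add: of_bool_def if_distrib[of "\<lambda>x. x * _"] cong: if_cong)
    finally have "z a = (\<Sum>b<n. \<Sum>i<n. P $$ (a, i) * Q $$ (i, b) * z b)"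
      by (simp add: sum_distrib_right)
    also have "\<dots> = (\<Sum>i<n. t i * P $$ (a, i))"
      by (subst sum.swap) (simp add: t_def sum_distrib_left ac_simps)
    finally show ?thesis .
  qed
  \<comment> \<open>Square roots of the eigenvalues turn the form into the squared norm of
    \<open>p\<close>; where d i < 0 the coordinate t i is 0.\<close>
  define r where "r i = complex_of_real (sqrt \<bar>d i\<bar>)" for i
  define p where "p a = (\<Sum>i<n. r i * t i * P $$ (a, i))" for a
  have "(\<Sum>a<n. \<Sum>b<n. cnj (z a) * A $$ (a, b) * z b)
    = (\<Sum>a<n. \<Sum>b<n. \<Sum>i<n. \<Sum>j<n. cnj (t i) * t j * (cnj (P $$ (a, i)) * A $$ (a, b) * P $$ (b, j)))"
    by (intro sum.cong refl) (simp add: z sum_product sum_distrib_left sum_distrib_right ac_simps)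
  also have "\<dots> = (\<Sum>i<n. \<Sum>j<n. \<Sum>a<n. \<Sum>b<n. cnj (t i) * t j * (cnj (P $$ (a, i)) * A $$ (a, b) * P $$ (b, j)))"
    by (rule sum_swap_pairs)
  also have "\<dots> = (\<Sum>i<n. \<Sum>j<n. cnj (t i) * t j * (of_real (d j) * (\<Sum>a<n. cnj (P $$ (a, i)) * P $$ (a, j))))"
    by (simp add: bil flip: sum_distrib_left)
  also have "\<dots> = (\<Sum>i<n. \<Sum>j<n. cnj (r i * t i) * (r j * t j) * (\<Sum>a<n. cnj (P $$ (a, i)) * P $$ (a, j)))"
  proof (intro sum.cong refl)
    fix i j assume ij: "i \<in> {..<n}" "j \<in> {..<n}"
    show "cnj (t i) * t j * (of_real (d j) * (\<Sum>a<n. cnj (P $$ (a, i)) * P $$ (a, j)))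
      = cnj (r i * t i) * (r j * t j) * (\<Sum>a<n. cnj (P $$ (a, i)) * P $$ (a, j))"
    \<comment> \<open>Equal nonnegative eigenvalues share their square root, distinct ones have
      orthogonal columns, and negative ones carry zero coordinates.\<close>
    proof (cases "d i = d j \<and> 0 \<le> d j")
      case True
      then have "cnj (r i) * r j = of_real (d j)" by (simp add: r_def flip: of_real_mult)
      then have "cnj (r i * t i) * (r j * t j) = cnj (t i) * t j * of_real (d j)"
        by (metis complex_cnj_mult mult.assoc mult.commute)
      then show ?thesis by (simp only: mult.assoc)
    next
      case False
      then show ?thesis using orth[of i j] t0[of j] ij by fastforce
    qed
  qed
  also have "\<dots> = (\<Sum>i<n. \<Sum>j<n. \<Sum>a<n. cnj (r i * t i * P $$ (a, i)) * (r j * t j * P $$ (a, j)))"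
    by (simp add: sum_distrib_left ac_simps)
  also have "\<dots> = (\<Sum>i<n. \<Sum>a<n. \<Sum>j<n. cnj (r i * t i * P $$ (a, i)) * (r j * t j * P $$ (a, j)))"
    by (intro sum.cong refl sum.swap)
  also have "\<dots> = (\<Sum>a<n. cnj (p a) * p a)"
    by (subst sum.swap) (simp only: p_def cnj_sum sum_product)
  also have "\<dots> = of_real (\<Sum>a<n. (cmod (p a))\<^sup>2)"
    by (simp add: complex_norm_square mult.commute del: of_real_power)
  finally have "0 \<le> Re (\<Sum>a<n. \<Sum>b<n. cnj (z a) * A $$ (a, b) * z b)"
    by (simp add: sum_nonneg del: of_real_sum)
  then show ?thesis using that[of c] c(1) by (auto simp: z_def)
qed

section \<open>Positive forms and functions\<close>

context complex_vector_space
begin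

text \<open>Polarization settles the real part, and the imaginary part is the real part at x and i
  y.\<close>

lemma hermitian_form_eqI:
  assumes S: "hermitian_form S" and S': "hermitian_form S'" and eq: "\<And>x. Re (S x x) = Re (S' x x)"
  shows "S x y = S' x y"
proof -
  have polar: "2 * Re (R x y) = Re (R (x + y) (x + y)) - Re (R x x) - Re (R y y)"
    if R: "hermitian_form R" for R x y
    using arg_cong[OF hermitian_form_commute[OF R, of y x], of Re] by (simp add: hermitian_form_simps[OF R])
  have Re: "Re (S x y) = Re (S' x y)" for x y
    using polar[OF S, of x y] polar[OF S', of x y] by (simp add: eq)
  have "Im (R x y) = Re (R x (\<i> *s y))" if R: "hermitian_form R" for R
    by (simp add: hermitian_form_simps[OF R])
  from this[OF S] this[OF S'] Re show ?thesis by (simp add: complex_eq_iff)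
qed

text \<open>For an eigenvector w, r |w|^2 is the value of the form at the combination of the
  \<open>v j\<close> with coefficients w.\<close>

lemma neg_eigenvalues_Gram_mat:
  assumes S: "hermitian_form S" and nn: "\<And>x. 0 \<le> Re (S x x)"
  shows "neg_eigenvalues (mat n n (\<lambda>(i, j). S (v j) (v i))) = {}"
proof -
  let ?A = "mat n n (\<lambda>(i, j). S (v j) (v i))"
  have "0 \<le> r" if ev: "eigenvalue ?A (of_real r)" for r
  proof -
    obtain w where w: "w \<in> carrier_vec n" "w \<noteq> 0\<^sub>v n" "?A *\<^sub>v w = of_real r \<cdot>\<^sub>v w"
      using ev by (auto simp: eigenvalue_def eigenvector_def)
    have row: "(\<Sum>j<n. S (v j) (v i) * w $ j) = of_real r * w $ i" if "i < n" for i
      using arg_cong[OF w(3), of "\<lambda>u. u $ i"] that w(1) by (simp add: scalar_prod_def atLeast0LessThan)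
    have "S (\<Sum>j<n. w $ j *s v j) (\<Sum>j<n. w $ j *s v j)
        = (\<Sum>i<n. cnj (w $ i) * (\<Sum>j<n. S (v j) (v i) * w $ j))"
      by (simp add: hermitian_form_simps[OF S] mult.commute)
    also have "\<dots> = (\<Sum>i<n. of_real r * (w $ i * cnj (w $ i)))"
      by (rule sum.cong) (simp_all add: row)
    also have "\<dots> = of_real (r * (\<Sum>i<n. (cmod (w $ i))\<^sup>2))"
      by (simp add: sum_distrib_left flip: complex_norm_square)
    finally have "0 \<le> r * (\<Sum>i<n. (cmod (w $ i))\<^sup>2)" by (metis nn Re_complex_of_real)
    moreover have "\<exists>i<n. w $ i \<noteq> 0" using w(1,2) by (metis carrier_vecD eq_vecI index_zero_vec)
    then have "0 < (\<Sum>i<n. (cmod (w $ i))\<^sup>2)" by (rule sum_cmod_square_pos)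
    ultimately show ?thesis by (simp add: zero_le_mult_iff)
  qed
  then show ?thesis by (force simp: neg_eigenvalues_def Reals_def)
qed

end

context form_representation
begin

lemma hermitian_fun_orbit: "hermitian_fun G (\<lambda>g. B (T g x) x)"
  unfolding hermitian_fun_def
proof
  fix g assume "g \<in> carrier G"
  then have "B (T (inv g) x) x = B x (T g x)" by (simp add: B_adjoint)
  also have "\<dots> = cnj (B (T g x) x)" by (rule hermitian_form_commute[OF B])
  finally show "B (T (inv g) x) x = cnj (B (T g x) x)" .
qed

lemma positive_definite_orbit:
  assumes nn: "\<And>x. 0 \<le> Re (B x x)"
  shows "positive_definite G (\<lambda>g. B (T g x) x)"
  unfolding positive_definite_def
proof (intro conjI allI impI hermitian_fun_orbit)
  fix n and g :: "nat \<Rightarrow> 'a" assume g: "\<forall>i<n. g i \<in> carrier G"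
  have "kernel_mat G (\<lambda>g. B (T g x) x) n g = mat n n (\<lambda>(i, j). B (T (g j) x) (T (g i) x))"
    unfolding kernel_mat_def using g by (intro cong_mat) (auto simp: T_mult B_adjoint')
  then show "neg_eigenvalues (kernel_mat G (\<lambda>g. B (T g x) x) n g) = {}"
    using neg_eigenvalues_Gram_mat[OF B nn, where v = "\<lambda>i. T (g i) x"] by simp
qed

text \<open>The quotient by the null vectors of B is a d-dimensional Hilbert space with basis
  \<open>u\<close>. Instead of forming it, the matrix of each T g is read off from \<open>u\<close>,
  with Parseval's identity in place of expansion in a basis.\<close>

lemma positive_definite_finite_type_orbit:
  assumes nn: "\<And>x. 0 \<le> Re (B x x)" and u: "orthonormal B d u" and max: "\<And>u'. \<not> orthonormal B (Suc d) u'"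
  shows "positive_definite_finite_type G (\<lambda>g. B (T g x) x)"
proof -
  have Parseval: "B y z = (\<Sum>l<d. B y (u l) * B (u l) z)" for y z
  proof -
    \<comment> \<open>The remainder satisfies B w w = 0, so Cauchy-Schwarz makes it orthogonal to
      every z.\<close>
    define w where "w = y - (\<Sum>l<d. B y (u l) *s u l)"
    have "Re (B w w) \<le> 0"
      unfolding w_def maximal_orthonormal_norm_le(2)[OF B u max] using maximal_orthonormal_norm_le(1)[OF B u max, of y] by simp
    then have "Re (B w w) = 0" using nn[of w] by simp
    then have "B w z = 0" using hermitian_form_Cauchy_Schwarz[OF B nn, of w z] by simp
    then show ?thesis by (simp add: w_def hermitian_form_simps[OF B])
  qed
  define \<pi> where "\<pi> g = mat d d (\<lambda>(i, j). B (T g (u j)) (u i))" for g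
  have \<pi>: "\<pi> g \<in> carrier_mat d d" for g by (simp add: \<pi>_def)
  have mult: "\<pi> (g \<otimes> h) = \<pi> g * \<pi> h" if "g \<in> carrier G" "h \<in> carrier G" for g h
  proof (rule eq_matI)
    fix i j assume "i < dim_row (\<pi> g * \<pi> h)" "j < dim_col (\<pi> g * \<pi> h)"
    then have ij: "i < d" "j < d" by (simp_all add: \<pi>_def)
    have "B (T (g \<otimes> h) (u j)) (u i) = (\<Sum>l<d. B (T h (u j)) (u l) * B (T g (u l)) (u i))"
      using Parseval[of "T h (u j)" "T (inv g) (u i)"] that by (simp add: T_mult B_adjoint[of g])
    then show "\<pi> (g \<otimes> h) $$ (i, j) = (\<pi> g * \<pi> h) $$ (i, j)"
      using ij by (simp add: \<pi>_def scalar_prod_def atLeast0LessThan mult.commute)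
  qed (simp_all add: \<pi>_def)
  have one: "\<pi> \<one> = 1\<^sub>m d"
    using u by (intro eq_matI) (auto simp: \<pi>_def T_one orthonormal_def)
  have adj: "mat_adjoint (\<pi> g) = \<pi> (inv g)" if g: "g \<in> carrier G" for g
  proof (rule eq_matI)
    fix i j assume "i < dim_row (\<pi> (inv g))" "j < dim_col (\<pi> (inv g))"
    then have ij: "i < d" "j < d" by (simp_all add: \<pi>_def)
    have "cnj (B (T g (u i)) (u j)) = B (T (inv g) (u j)) (u i)"
      using g by (simp add: B_adjoint' flip: hermitian_form_commute[OF B])
    then show "mat_adjoint (\<pi> g) $$ (i, j) = \<pi> (inv g) $$ (i, j)"
      using ij by (simp add: mat_adjoint_index[OF \<pi>]) (simp add: \<pi>_def)
  qed (use mat_adjoint_carrier[OF \<pi>, of g] in \<open>simp_all add: \<pi>_def\<close>)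
  have "\<pi> \<in> hom G (unitary_group d)"
    by (rule homI) (simp_all add: unitary_group_def \<pi> adj mult one flip: mult)
  moreover define y where "y = vec d (\<lambda>i. B x (u i))"
  moreover have "B (T g x) x = (\<pi> g *\<^sub>v y) \<bullet>c y" if g: "g \<in> carrier G" for g
  proof -
    have "B (T g x) (u i) = (\<Sum>j<d. B x (u j) * B (T g (u j)) (u i))" for i
      using Parseval[of x "T (inv g) (u i)"] g by (simp add: B_adjoint)
    then have "(\<pi> g *\<^sub>v y) $ i = B (T g x) (u i)" if "i < d" for i
      using that by (simp add: \<pi>_def y_def scalar_prod_def atLeast0LessThan mult.commute)
    then have "(\<pi> g *\<^sub>v y) \<bullet>c y = (\<Sum>i<d. B (T g x) (u i) * cnj (B x (u i)))"
      by (simp add: scalar_prod_def y_def atLeast0LessThan)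
    also have "\<dots> = B (T g x) x"
      unfolding Parseval[of "T g x" x] hermitian_form_commute[OF B, of "u _" x] ..
    finally show ?thesis ..
  qed
  ultimately show ?thesis
    unfolding positive_definite_finite_type_def by (intro exI[of _ d] bexI[of _ \<pi>] bexI[of _ y]) auto
qed

end

section \<open>From functions on the group to forms and back\<close>

context group
begin

text \<open>The order \<open>inv t \<otimes> s\<close> makes the kernel left invariant and lets the
  orbit of the unit point mass return \<phi>. Points outside the carrier become null
  vectors.\<close>

definition fun_kernel :: "('a \<Rightarrow> complex) \<Rightarrow> 'a \<Rightarrow> 'a \<Rightarrow> complex" where
  "fun_kernel \<phi> s t = (if s \<in> carrier G \<and> t \<in> carrier G then \<phi> (inv t \<otimes> s) else 0)"

lemma fun_kernel_commute: "hermitian_fun G \<phi> \<Longrightarrow> fun_kernel \<phi> t s = cnj (fun_kernel \<phi> s t)"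
  unfolding fun_kernel_def hermitian_fun_def
  by (auto simp: inv_mult_group dest!: bspec[of _ _ "inv t \<otimes> s"])

text \<open>The supports involve only finitely many group elements, on which the form is that of a
  kernel matrix. If m > k, \<open>nonnegative_combination\<close> would give a nontrivial
  combination with nonnegative value.\<close>

lemma negative_family_bound:
  assumes herm: "hermitian_fun G \<phi>"
    and k: "\<And>n g. \<forall>i<n. g i \<in> carrier G \<Longrightarrow> num_neg_eigenvalues (kernel_mat G \<phi> n g) \<le> k"
    and y: "free.negative_family (\<lambda>x. Re (kernel_form (fun_kernel \<phi>) x x)) m y"
  shows "m \<le> k"
proof (rule ccontr)
  assume "\<not> m \<le> k"
  define X where "X = (\<Union>j<m. Poly_Mapping.keys (y j))"
  have "finite (X \<inter> carrier G)" by (simp add: X_def)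
  then obtain g where g: "bij_betw g {..<card (X \<inter> carrier G)} (X \<inter> carrier G)"
    using ex_bij_betw_nat_finite atLeast0LessThan by metis
  define n where "n = card (X \<inter> carrier G)"
  have gG: "g i \<in> carrier G" if "i < n" for i using g that by (auto simp: n_def bij_betw_def)
  define A where "A = kernel_mat G \<phi> n g"
  have A: "A \<in> carrier_mat n n" by (simp add: A_def kernel_mat_def)
  \<comment> \<open>The matrix is the transpose of \<open>fun_kernel\<close> along g, hence the
    exchange of the two sums further down.\<close>
  have entry: "A $$ (i, j) = fun_kernel \<phi> (g j) (g i)" if "i < n" "j < n" for i j
    using that gG by (simp add: A_def kernel_mat_def fun_kernel_def)
  have A_herm: "A $$ (j, i) = cnj (A $$ (i, j))" if "i < n" "j < n" for i j
    unfolding entry[OF that] entry[OF that(2,1)] by (rule fun_kernel_commute[OF herm])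
  have less: "num_neg_eigenvalues A < m" using k[of n g] gG \<open>\<not> m \<le> k\<close> by (simp add: A_def)
  obtain c where c: "\<exists>j<m. c j \<noteq> 0"
    and nn: "0 \<le> Re (\<Sum>a<n. \<Sum>b<n. cnj (\<Sum>j<m. c j * coeff_at (y j) (g a)) * A $$ (a, b) * (\<Sum>j<m. c j * coeff_at (y j) (g b)))"
    by (rule nonnegative_combination[of A n m "\<lambda>j a. coeff_at (y j) (g a)"])
      (use A A_herm less in blast)+
  define z where "z = (\<Sum>j<m. smul (c j) (y j))"
  have z: "coeff_at z a = (\<Sum>j<m. c j * coeff_at (y j) a)" for a by (simp add: z_def lookup_sum)
  have fin: "finite X" by (simp add: X_def)
  have "Poly_Mapping.keys z \<subseteq> X"
  proof
    fix a assume "a \<in> Poly_Mapping.keys z"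
    then show "a \<in> X"
      by (intro ccontr[of "a \<in> X"]) (auto simp: in_keys_iff z X_def)
  qed
  then have "kernel_form (fun_kernel \<phi>) z z = (\<Sum>a\<in>X. \<Sum>b\<in>X. coeff_at z a * cnj (coeff_at z b) * fun_kernel \<phi> a b)"
    unfolding kernel_form_def by (simp add: lin_ext_superset[OF fin] sum_distrib_left mult.assoc)
  also have "\<dots> = (\<Sum>a\<in>X \<inter> carrier G. \<Sum>b\<in>X \<inter> carrier G. coeff_at z a * cnj (coeff_at z b) * fun_kernel \<phi> a b)"
  proof (rule sum.mono_neutral_cong_right[OF fin])
    fix a
    show "(\<Sum>b\<in>X. coeff_at z a * cnj (coeff_at z b) * fun_kernel \<phi> a b)
      = (\<Sum>b\<in>X \<inter> carrier G. coeff_at z a * cnj (coeff_at z b) * fun_kernel \<phi> a b)"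
      by (rule sum.mono_neutral_right[OF fin]) (auto simp: fun_kernel_def)
  qed (auto simp: fun_kernel_def)
  also have "\<dots> = (\<Sum>b<n. \<Sum>a<n. coeff_at z (g b) * cnj (coeff_at z (g a)) * fun_kernel \<phi> (g b) (g a))"
    unfolding n_def by (simp add: sum.reindex_bij_betw[OF g, symmetric])
  also have "\<dots> = (\<Sum>a<n. \<Sum>b<n. cnj (coeff_at z (g a)) * A $$ (a, b) * coeff_at z (g b))"
    by (subst sum.swap) (simp add: entry ac_simps)
  finally have "0 \<le> Re (kernel_form (fun_kernel \<phi>) z z)" using nn by (simp only: z)
  then show False using y c unfolding free.negative_family_def z_def by (meson not_le)
qed

theorem bounded_quasi_positive_definite_decomposition:
  assumes "\<exists>C. \<forall>g \<in> carrier G. cmod (\<phi> g) \<le> C" and "quasi_positive_definite G \<phi>"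
  obtains \<phi>\<^sub>1 \<phi>\<^sub>2 where "positive_definite G \<phi>\<^sub>1" "positive_definite_finite_type G \<phi>\<^sub>2"
    "\<And>g. g \<in> carrier G \<Longrightarrow> \<phi> g = \<phi>\<^sub>1 g - \<phi>\<^sub>2 g"
proof -
  obtain C where C: "\<And>g. g \<in> carrier G \<Longrightarrow> cmod (\<phi> g) \<le> C" using assms(1) by blast
  obtain k where herm: "hermitian_fun G \<phi>"
    and k: "\<And>n g. \<forall>i<n. g i \<in> carrier G \<Longrightarrow> num_neg_eigenvalues (kernel_mat G \<phi> n g) \<le> k"
    using assms(2) unfolding quasi_positive_definite_def by blast
  define B where "B = kernel_form (fun_kernel \<phi>)"
  have B: "free.hermitian_form B"
    unfolding B_def by (rule hermitian_kernel_form) (rule fun_kernel_commute[OF herm])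
  have "fun_kernel \<phi> (shift s a) (shift s c) = fun_kernel \<phi> a c" if "s \<in> carrier G" for s a c
  proof (cases "a \<in> carrier G \<and> c \<in> carrier G")
    case True
    then have "inv (s \<otimes> c) \<otimes> (s \<otimes> a) = inv c \<otimes> (inv s \<otimes> s \<otimes> a)"
      using that by (simp only: inv_mult_group m_assoc inv_closed m_closed)
    then show ?thesis using True that by (simp add: fun_kernel_def shift_def)
  qed (auto simp: fun_kernel_def shift_def)
  then have B_inv: "B (translate s x) (translate s y) = B x y" if "s \<in> carrier G" for s x y
    using that by (simp add: B_def kernel_form_translate)
  have bounded: "\<exists>M. \<forall>s\<in>carrier G. cmod (B (translate s x) y) \<le> M" for x y
  proof -
    have C0: "0 \<le> C" using C[of \<one>] norm_ge_zero[of "\<phi> \<one>"] by (simp del: norm_ge_zero)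
    have K: "cmod (fun_kernel \<phi> a c) \<le> C" for a c using C C0 by (simp add: fun_kernel_def)
    have "cmod (B (translate s x) y) \<le> (\<Sum>a\<in>Poly_Mapping.keys x. \<Sum>c\<in>Poly_Mapping.keys y.
        cmod (coeff_at x a) * cmod (coeff_at y c) * C)" if "s \<in> carrier G" for s
    proof -
      \<comment> \<open>Translation moves the arguments of the kernel and leaves the coefficients in
        place, so the bound does not depend on s.\<close>
      have "B (translate s x) y = (\<Sum>a\<in>Poly_Mapping.keys x. \<Sum>c\<in>Poly_Mapping.keys y.
          coeff_at x a * cnj (coeff_at y c) * fun_kernel \<phi> (shift s a) c)"
        unfolding B_def kernel_form_def lin_ext_translate[OF that]
        by (simp add: lin_ext_def sum_distrib_left mult.assoc)
      then show ?thesis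
        by (auto intro!: sum_norm_le mult_left_mono K simp: norm_mult)
    qed
    then show ?thesis by blast
  qed
  have rep: "form_representation smul G translate S"
    if "free.hermitian_form S" "\<And>s x y. s \<in> carrier G \<Longrightarrow> S (translate s x) (translate s y) = S x y" for S
    by unfold_locales (simp_all add: that translate_add translate_smul translate_mult translate_one)
  have neg_bound: "m \<le> k" if "free.negative_family (\<lambda>x. Re (B x x)) m y" for m y
    using negative_family_bound[OF herm k] that unfolding B_def by blast
  obtain m e where e: "free.orthonormal (\<lambda>x y. - B x y) m e"
    and e_max: "\<And>e'. \<not> free.orthonormal (\<lambda>x y. - B x y) (Suc m) e'"
    using free.maximal_orthonormal[of "\<lambda>x y. - B x y" k] free.negative_family_orthonormal[OF B] neg_bound by blast
  interpret R: bounded_quasi_definite_representation smul G translate B m e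
    by (intro bounded_quasi_definite_representation.intro rep B B_inv
        bounded_quasi_definite_representation_axioms.intro bounded e e_max)
  let ?T = "translate ` carrier G"
  obtain N where N: "free.pos_form N" "free.pos_form (\<lambda>x. N x + R.b x)"
    "\<And>s x. s \<in> carrier G \<Longrightarrow> N (translate s x) = N x"
    by (rule R.invariant_majorant) blast
  obtain M where M: "free.pos_form M" "free.pos_form (\<lambda>x. M x + R.b x)"
    and sing: "\<And>x. free.parallel_sum M (\<lambda>x. M x + R.b x) x = 0"
    and M_inv': "\<And>\<tau> x. \<tau> \<in> ?T \<Longrightarrow> M (\<tau> x) = M x"
    by (rule free.singular_decomposition[OF R.quad_b N(1,2), of ?T])
      (auto simp: R.T_diff R.surj_T R.b_invariant N(3))
  have M_inv: "M (translate s x) = M x" if "s \<in> carrier G" for s x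
    using that by (intro M_inv') simp
  obtain S where S: "free.hermitian_form S" and SM: "\<And>x. Re (S x x) = M x"
    by (rule free.Jordan_von_Neumann[OF M(1)]) blast
  have S_inv: "S (translate s x) (translate s y) = S x y" if "s \<in> carrier G" for s x y
  proof -
    have "free.hermitian_form (\<lambda>x y. S (translate s x) (translate s y))"
      by (rule free.hermitian_formI) (simp_all add: that translate_add translate_smul free.hermitian_form_simps[OF S]
          flip: free.hermitian_form_commute[OF S])
    then show ?thesis by (rule free.hermitian_form_eqI[OF _ S]) (simp add: SM M_inv that)
  qed
  \<comment> \<open>Here singularity bounds the rank of \<open>S\<close> by k, which is what makes
    \<phi>2 of finite type.\<close>
  have "n \<le> k" if "free.orthonormal S n u" for n u
    by (rule free.singular_negative_family[OF S SM M sing that])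
      (rule neg_bound, simp add: R.b_def[abs_def])
  then obtain d u where u: "free.orthonormal S d u" and u_max: "\<And>u'. \<not> free.orthonormal S (Suc d) u'"
    using free.maximal_orthonormal by blast
  define P where "P x y = B x y + S x y" for x y
  have P: "free.hermitian_form P"
    using R.hermitian_form_combine[OF B S, of 1 1] by (simp add: P_def[abs_def])
  have P_inv: "P (translate s x) (translate s y) = P x y" if "s \<in> carrier G" for s x y
    using that by (simp add: P_def B_inv S_inv)
  have S_nn: "0 \<le> Re (S x x)" for x using M(1) by (simp add: SM free.pos_form_def)
  have P_nn: "0 \<le> Re (P x x)" for x
    using M(2) by (simp add: P_def SM R.b_def free.pos_form_def add.commute)
  define \<delta> where "\<delta> = Poly_Mapping.single \<one> (1::complex)"
  define \<phi>1 \<phi>2 where "\<phi>1 g = P (translate g \<delta>) \<delta>" and "\<phi>2 g = S (translate g \<delta>) \<delta>" for g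
  have "positive_definite G \<phi>1"
    unfolding \<phi>1_def[abs_def] by (rule form_representation.positive_definite_orbit[OF rep[OF P P_inv] P_nn])
  moreover have "positive_definite_finite_type G \<phi>2"
    unfolding \<phi>2_def[abs_def]
    by (rule form_representation.positive_definite_finite_type_orbit[OF rep[OF S S_inv] S_nn u u_max])
  moreover have "\<phi> g = \<phi>1 g - \<phi>2 g" if "g \<in> carrier G" for g
  proof -
    have "B (translate g \<delta>) \<delta> = \<phi> g"
      using that by (simp add: B_def \<delta>_def translate_single fun_kernel_def)
    then show ?thesis by (simp add: \<phi>1_def \<phi>2_def P_def)
  qed
  ultimately show ?thesis by (rule that)
qed

end

theorem theorem5p1:
  fixes G :: "('a, 'b) monoid_scheme" and \<phi> :: "'a \<Rightarrow> complex"
  assumes "group G"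
    and "\<exists>C. \<forall>g \<in> carrier G. cmod (\<phi> g) \<le> C"
    and "quasi_positive_definite G \<phi>"
  shows "\<exists>\<phi>\<^sub>1 \<phi>\<^sub>2. positive_definite G \<phi>\<^sub>1 \<and> positive_definite_finite_type G \<phi>\<^sub>2 \<and>
           (\<forall>g \<in> carrier G. \<phi> g = \<phi>\<^sub>1 g - \<phi>\<^sub>2 g)"
  using group.bounded_quasi_positive_definite_decomposition[OF assms] by metis

end
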